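(* For all closed terms $t_0,t_1$ of $\lambda_S$: $t_0\cong t_1$ iff $(\emptyset,\emptyset,t_0)\approx_{env}(\emptyset,\emptyset,t_1)$; and $t_0\cong_p t_1$ iff $(\emptyset,\emptyset,t_0)\approx_{env}^{p}(\emptyset,\emptyset,t_1)$.
   Context: Calculus $\lambda_S$: terms $t ::= v \mid t\,t \mid \mathcal{S}k.t \mid \langle t\rangle$, values $v ::= x \mid \lambda x.t$; pure contexts $E ::= \square \mid v\,E \mid E\,t$; evaluation contexts $F ::= \square \mid v\,F \mid F\,t \mid \langle F\rangle$ (every evaluation context is either pure or uniquely of the form $F[\langle E\rangle]$ with $E$ pure); contexts $C ::= \square \mid \lambda x.C \mid t\,C \mid C\,t \mid \mathcal{S}k.C \mid \langle C\rangle$. Reduction: $F[(\lambda x.t)\,v] \to F[t\{v/x\}]$; $F[\langle E[\mathcal{S}k.t]\rangle] \to F[\langle t\{\lambda x.\langle E[x]\rangle/k\}\rangle]$ ($x\notin\mathrm{fv}(E)$); $F[\langle v\rangle]\to F[v]$. Stuck: non-value that does not reduce; control-stuck: $E[\mathcal{S}k.t]$; normal form: value or stuck; $t\Downarrow t'$: $t\to^* t'$, $t'$ normal form. $s\hookrightarrow s'$ iff $s\to s'$, or $s$ is a normal form and $s'=s$. Contextual equivalences (closed terms): $t_0\cong t_1$ iff for every closed $C$, $C[t_0]$ evaluates to a value iff $C[t_1]$ does, and $C[t_0]$ evaluates to a control-stuck term iff $C[t_1]$ does; $t_0\cong_p t_1$ iff for every closed $C$, $\langle C[t_0]\rangle$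 evaluates to a value iff $\langle C[t_1]\rangle$ does. Multi-hole contexts: $\mathbb{C} ::= \mathbb{V} \mid \mathbb{C}\,\mathbb{C} \mid \langle\mathbb{C}\rangle \mid \mathcal{S}k.\mathbb{C} \mid \blacksquare_j[\mathbb{C}]$; $\mathbb{V} ::= x \mid \lambda x.\mathbb{C} \mid \square_i$; $\mathbb{F} ::= \square \mid \mathbb{F}\,\mathbb{C} \mid \mathbb{V}\,\mathbb{F} \mid \langle\mathbb{F}\rangle \mid \blacksquare_j[\mathbb{F}]$ ($i,j\ge1$). For a finite sequence $\Gamma$ of closed values and a finite sequence $\Phi$ of closed evaluation contexts, $\mathbb{C}[\Phi;\Gamma]$ replaces each $\square_i$ by $\Gamma_i$ and each $\blacksquare_j[\cdot]$ by plugging into $\Phi_j$ (indices assumed in range); $\mathbb{F}[t;\Phi;\Gamma]$ additionally fills the hole $\square$ with $t$, and $\mathbb{F}[\Phi;\Gamma]$ is the resulting evaluation context with $\square$ left open. All multi-hole contexts used in transitions are closed. States: term states $(\Phi,\Gamma,t)$ ($t$ closed) and environment states $(\Phi,\Gamma)$. Relaxed LTS: if $t\to t'$ then $(\Phi,\Gamma,t)\xrightarrow{\tau}(\Phi,\Gamma,t')$; if $\Gamma_i=\lambda x.t$ then $(\Phi,\Gamma)\xrightarrow{\lambda,i,\mathbb{V}}(\Phi,\Gamma,t\{\mathbb{V}[\Phi;\Gamma]/x\})$; $(\Phi,\Gamma,v)\xrightarrow{\downarrow}(\Phi,(\Gamma,v))$; if $t$ is stuck and $\mathbb{F}[t;\Phi;\Gamma]\hookrightarrow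 t'$ then $(\Phi,\Gamma,t)\xrightarrow{\mathbb{F}}(\Phi,\Gamma,t')$; $(\Phi,\Gamma)\xrightarrow{\square,j,\mathbb{V}}(\Phi,\Gamma,\Phi_j[\mathbb{V}[\Phi;\Gamma]])$; if $\Phi_j$ is pure then $(\Phi,\Gamma)\xrightarrow{pure,j}(\Phi,\Gamma)$; if $\Phi_j=F[\langle E\rangle]$ with $E$ pure then $(\Phi,\Gamma)\xrightarrow{split,j}((\Phi,F[\langle\square\rangle],\langle E\rangle),\Gamma)$. Original LTS, on pure states $(\Phi,\Gamma,p)$ with $p ::= v\mid\langle t\rangle$ and environment states, where an evaluation context is delimited if it is of the form $\langle F'\rangle$: if $p\to p'$ then $(\Phi,\Gamma,p)\xrightarrow{\tau}(\Phi,\Gamma,p')$; if $\Gamma_i=\lambda x.t$ and $\mathbb{F}[\Phi;\Gamma]$ is delimited then $(\Phi,\Gamma)\xrightarrow{\lambda,i,\mathbb{V},\mathbb{F}}(\Phi,\Gamma,\mathbb{F}[t\{\mathbb{V}[\Phi;\Gamma]/x\};\Phi;\Gamma])$; $(\Phi,\Gamma,v)\xrightarrow{\downarrow}(\Phi,(\Gamma,v))$; if $\mathbb{F}[\Phi;\Gamma]$ is delimited then $(\Phi,\Gamma)\xrightarrow{\square,j,\mathbb{V},\mathbb{F}}(\Phi,\Gamma,\mathbb{F}[\Phi_j[\mathbb{V}[\Phi;\Gamma]];\Phi;\Gamma])$; and the $pure,j$ and $split,j$ transitions as in the relaxed LTS. For each LTS: $\overset{\tau}{\Rightarrow}$ is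 the reflexive-transitive closure of $\xrightarrow{\tau}$ and $\overset{\alpha}{\Rightarrow}=\overset{\tau}{\Rightarrow}\xrightarrow{\alpha}\overset{\tau}{\Rightarrow}$ for $\alpha\neq\tau$. A bisimulation is a relation $R$ on states such that whenever $s\,R\,s'$ and $s\xrightarrow{\alpha}s_1$ there is $s_1'$ with $s'\overset{\alpha}{\Rightarrow}s_1'$ and $s_1\,R\,s_1'$, and symmetrically. $\approx_{env}$ is the largest bisimulation for the relaxed LTS; $\approx_{env}^p$ the largest for the original LTS. For arbitrary closed terms, $(\emptyset,\emptyset,t_0)\approx_{env}^p(\emptyset,\emptyset,t_1)$ means: for every closed pure context $E$, $(\emptyset,\emptyset,\langle E[t_0]\rangle)\approx_{env}^p(\emptyset,\emptyset,\langle E[t_1]\rangle)$. *)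

theory Defs
  imports Main
begin

section \<open>Syntax\<close>

text \<open>Terms are represented with de Bruijn indices, so \<open>\<alpha>\<close>-equivalence is equality.
  \<open>Lam t\<close> and \<open>Shift t\<close> bind index \<open>0\<close> in \<open>t\<close>.\<close>

datatype trm = Val val | App trm trm | Shift trm | Reset trm
  and val = Var nat | Lam trm

text \<open>Evaluation contexts; the pure ones are those without a delimiter around the hole.\<close>

datatype ectx = EHole | EAppR val ectx | EAppL ectx trm | EReset ectx

primrec pure_ectx :: "ectx \<Rightarrow> bool" where
  "pure_ectx EHole \<longleftrightarrow> True"
| "pure_ectx (EAppR v F) \<longleftrightarrow> pure_ectx F"
| "pure_ectx (EAppL F t) \<longleftrightarrow> pure_ectx F"
| "pure_ectx (EReset F) \<longleftrightarrow> False"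

primrec eplug :: "ectx \<Rightarrow> trm \<Rightarrow> trm" where
  "eplug EHole u = u"
| "eplug (EAppR v F) u = App (Val v) (eplug F u)"
| "eplug (EAppL F t) u = App (eplug F u) t"
| "eplug (EReset F) u = Reset (eplug F u)"

primrec ecomp :: "ectx \<Rightarrow> ectx \<Rightarrow> ectx" where
  "ecomp EHole G = G"
| "ecomp (EAppR v F) G = EAppR v (ecomp F G)"
| "ecomp (EAppL F t) G = EAppL (ecomp F G) t"
| "ecomp (EReset F) G = EReset (ecomp F G)"

datatype ctx = CHole | CLam ctx | CAppR trm ctx | CAppL ctx trm | CShift ctx | CReset ctx

text \<open>Plugging may capture variables, hence no index is shifted.\<close>

primrec cplug :: "ctx \<Rightarrow> trm \<Rightarrow> trm" where
  "cplug CHole u = u"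
| "cplug (CLam C) u = Val (Lam (cplug C u))"
| "cplug (CAppR t C) u = App t (cplug C u)"
| "cplug (CAppL C t) u = App (cplug C u) t"
| "cplug (CShift C) u = Shift (cplug C u)"
| "cplug (CReset C) u = Reset (cplug C u)"

text \<open>The predicates \<open>closed_at_X n\<close> say that all free indices are below \<open>n\<close>.\<close>

primrec closed_at_trm :: "nat \<Rightarrow> trm \<Rightarrow> bool"
  and closed_at_val :: "nat \<Rightarrow> val \<Rightarrow> bool" where
  "closed_at_trm n (Val v) \<longleftrightarrow> closed_at_val n v"
| "closed_at_trm n (App t u) \<longleftrightarrow> closed_at_trm n t \<and> closed_at_trm n u"
| "closed_at_trm n (Shift t) \<longleftrightarrow> closed_at_trm (Suc n) t"
| "closed_at_trm n (Reset t) \<longleftrightarrow> closed_at_trm n t"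
| "closed_at_val n (Var i) \<longleftrightarrow> i < n"
| "closed_at_val n (Lam t) \<longleftrightarrow> closed_at_trm (Suc n) t"

primrec closed_at_ectx :: "nat \<Rightarrow> ectx \<Rightarrow> bool" where
  "closed_at_ectx n EHole \<longleftrightarrow> True"
| "closed_at_ectx n (EAppR v F) \<longleftrightarrow> closed_at_val n v \<and> closed_at_ectx n F"
| "closed_at_ectx n (EAppL F t) \<longleftrightarrow> closed_at_ectx n F \<and> closed_at_trm n t"
| "closed_at_ectx n (EReset F) \<longleftrightarrow> closed_at_ectx n F"

primrec closed_at_ctx :: "nat \<Rightarrow> ctx \<Rightarrow> bool" where
  "closed_at_ctx n CHole \<longleftrightarrow> True"
| "closed_at_ctx n (CLam C) \<longleftrightarrow> closed_at_ctx (Suc n) C"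
| "closed_at_ctx n (CAppR t C) \<longleftrightarrow> closed_at_trm n t \<and> closed_at_ctx n C"
| "closed_at_ctx n (CAppL C t) \<longleftrightarrow> closed_at_ctx n C \<and> closed_at_trm n t"
| "closed_at_ctx n (CShift C) \<longleftrightarrow> closed_at_ctx (Suc n) C"
| "closed_at_ctx n (CReset C) \<longleftrightarrow> closed_at_ctx n C"

abbreviation closed_trm :: "trm \<Rightarrow> bool" where "closed_trm \<equiv> closed_at_trm 0"
abbreviation closed_val :: "val \<Rightarrow> bool" where "closed_val \<equiv> closed_at_val 0"
abbreviation closed_ectx :: "ectx \<Rightarrow> bool" where "closed_ectx \<equiv> closed_at_ectx 0"
abbreviation closed_ctx :: "ctx \<Rightarrow> bool" where "closed_ctx \<equiv> closed_at_ctx 0"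

section \<open>Substitution and reduction\<close>

primrec lift_trm :: "nat \<Rightarrow> trm \<Rightarrow> trm"
  and lift_val :: "nat \<Rightarrow> val \<Rightarrow> val" where
  "lift_trm k (Val v) = Val (lift_val k v)"
| "lift_trm k (App t u) = App (lift_trm k t) (lift_trm k u)"
| "lift_trm k (Shift t) = Shift (lift_trm (Suc k) t)"
| "lift_trm k (Reset t) = Reset (lift_trm k t)"
| "lift_val k (Var i) = Var (if i < k then i else Suc i)"
| "lift_val k (Lam t) = Lam (lift_trm (Suc k) t)"

primrec lift_ectx :: "nat \<Rightarrow> ectx \<Rightarrow> ectx" where
  "lift_ectx k EHole = EHole"
| "lift_ectx k (EAppR v F) = EAppR (lift_val k v) (lift_ectx k F)"
| "lift_ectx k (EAppL F t) = EAppL (lift_ectx k F) (lift_trm k t)"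
| "lift_ectx k (EReset F) = EReset (lift_ectx k F)"

text \<open>\<open>subst_trm k w t\<close> replaces index \<open>k\<close> of \<open>t\<close> by the value \<open>w\<close> and lowers the indices
  above \<open>k\<close>, as the binder of \<open>k\<close> disappears.\<close>

primrec subst_trm :: "nat \<Rightarrow> val \<Rightarrow> trm \<Rightarrow> trm"
  and subst_val :: "nat \<Rightarrow> val \<Rightarrow> val \<Rightarrow> val" where
  "subst_trm k w (Val v) = Val (subst_val k w v)"
| "subst_trm k w (App t u) = App (subst_trm k w t) (subst_trm k w u)"
| "subst_trm k w (Shift t) = Shift (subst_trm (Suc k) (lift_val 0 w) t)"
| "subst_trm k w (Reset t) = Reset (subst_trm k w t)"
| "subst_val k w (Var i) = (if i < k then Var i else if i = k then w else Var (i - 1))"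
| "subst_val k w (Lam t) = Lam (subst_trm (Suc k) (lift_val 0 w) t)"

text \<open>The captured continuation \<open>\<lambda>x. \<langle>E[x]\<rangle>\<close>; lifting \<open>E\<close> makes \<open>x\<close> fresh for it.\<close>

definition reify :: "ectx \<Rightarrow> val" where
  "reify E = Lam (Reset (eplug (lift_ectx 0 E) (Val (Var 0))))"

inductive red :: "trm \<Rightarrow> trm \<Rightarrow> bool" where
  red_beta: "red (eplug F (App (Val (Lam t)) (Val v))) (eplug F (subst_trm 0 v t))"
| red_shift: "pure_ectx E \<Longrightarrow>
    red (eplug F (Reset (eplug E (Shift t)))) (eplug F (Reset (subst_trm 0 (reify E) t)))"
| red_reset: "red (eplug F (Reset (Val v))) (eplug F (Val v))"

definition is_value :: "trm \<Rightarrow> bool" where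
  "is_value t \<longleftrightarrow> (\<exists>v. t = Val v)"

definition stuck :: "trm \<Rightarrow> bool" where
  "stuck t \<longleftrightarrow> \<not> is_value t \<and> \<not> (\<exists>t'. red t t')"

definition control_stuck :: "trm \<Rightarrow> bool" where
  "control_stuck t \<longleftrightarrow> (\<exists>E u. pure_ectx E \<and> t = eplug E (Shift u))"

definition normal_form :: "trm \<Rightarrow> bool" where
  "normal_form t \<longleftrightarrow> is_value t \<or> stuck t"

definition evaluates :: "trm \<Rightarrow> trm \<Rightarrow> bool" where
  "evaluates t t' \<longleftrightarrow> red\<^sup>*\<^sup>* t t' \<and> normal_form t'"

definition red_or_nf :: "trm \<Rightarrow> trm \<Rightarrow> bool" where
  "red_or_nf s s' \<longleftrightarrow> red s s' \<or> (normal_form s \<and> s' = s)"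

section \<open>Contextual equivalences\<close>

definition evaluates_to_value :: "trm \<Rightarrow> bool" where
  "evaluates_to_value t \<longleftrightarrow> (\<exists>t'. evaluates t t' \<and> is_value t')"

definition evaluates_to_control_stuck :: "trm \<Rightarrow> bool" where
  "evaluates_to_control_stuck t \<longleftrightarrow> (\<exists>t'. evaluates t t' \<and> control_stuck t')"

definition ctx_equiv :: "trm \<Rightarrow> trm \<Rightarrow> bool" where
  "ctx_equiv t0 t1 \<longleftrightarrow> (\<forall>C. closed_ctx C \<longrightarrow>
     (evaluates_to_value (cplug C t0) \<longleftrightarrow> evaluates_to_value (cplug C t1)) \<and>
     (evaluates_to_control_stuck (cplug C t0) \<longleftrightarrow> evaluates_to_control_stuck (cplug C t1)))"

definition ctx_equiv_p :: "trm \<Rightarrow> trm \<Rightarrow> bool" where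
  "ctx_equiv_p t0 t1 \<longleftrightarrow> (\<forall>C. closed_ctx C \<longrightarrow>
     (evaluates_to_value (Reset (cplug C t0)) \<longleftrightarrow> evaluates_to_value (Reset (cplug C t1))))"

section \<open>Multi-hole contexts\<close>

text \<open>\<open>MHole i\<close> is the value hole \<open>\<box>\<^sub>i\<close> and \<open>MCtx j C\<close>, \<open>MECtx j F\<close> are the context holes
  \<open>\<blacksquare>\<^sub>j[C]\<close>, \<open>\<blacksquare>\<^sub>j[F]\<close>. Sequences are lists, so \<open>i\<close> and \<open>j\<close> count from \<open>0\<close>.\<close>

datatype mctx = MVal mval | MApp mctx mctx | MReset mctx | MShift mctx | MCtx nat mctx
  and mval = MVar nat | MLam mctx | MHole nat

datatype mectx = MEHole | MEAppL mectx mctx | MEAppR mval mectx | MEReset mectx | MECtx nat mectx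

text \<open>All free indices are below \<open>n\<close>, and all hole indices are in range for \<open>\<Phi>\<close> and \<open>\<Gamma>\<close>.\<close>

primrec mctx_ok :: "ectx list \<Rightarrow> val list \<Rightarrow> nat \<Rightarrow> mctx \<Rightarrow> bool"
  and mval_ok :: "ectx list \<Rightarrow> val list \<Rightarrow> nat \<Rightarrow> mval \<Rightarrow> bool" where
  "mctx_ok \<Phi> \<Gamma> n (MVal V) \<longleftrightarrow> mval_ok \<Phi> \<Gamma> n V"
| "mctx_ok \<Phi> \<Gamma> n (MApp C D) \<longleftrightarrow> mctx_ok \<Phi> \<Gamma> n C \<and> mctx_ok \<Phi> \<Gamma> n D"
| "mctx_ok \<Phi> \<Gamma> n (MReset C) \<longleftrightarrow> mctx_ok \<Phi> \<Gamma> n C"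
| "mctx_ok \<Phi> \<Gamma> n (MShift C) \<longleftrightarrow> mctx_ok \<Phi> \<Gamma> (Suc n) C"
| "mctx_ok \<Phi> \<Gamma> n (MCtx j C) \<longleftrightarrow> j < length \<Phi> \<and> mctx_ok \<Phi> \<Gamma> n C"
| "mval_ok \<Phi> \<Gamma> n (MVar i) \<longleftrightarrow> i < n"
| "mval_ok \<Phi> \<Gamma> n (MLam C) \<longleftrightarrow> mctx_ok \<Phi> \<Gamma> (Suc n) C"
| "mval_ok \<Phi> \<Gamma> n (MHole i) \<longleftrightarrow> i < length \<Gamma>"

primrec mectx_ok :: "ectx list \<Rightarrow> val list \<Rightarrow> nat \<Rightarrow> mectx \<Rightarrow> bool" where
  "mectx_ok \<Phi> \<Gamma> n MEHole \<longleftrightarrow> True"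
| "mectx_ok \<Phi> \<Gamma> n (MEAppL F C) \<longleftrightarrow> mectx_ok \<Phi> \<Gamma> n F \<and> mctx_ok \<Phi> \<Gamma> n C"
| "mectx_ok \<Phi> \<Gamma> n (MEAppR V F) \<longleftrightarrow> mval_ok \<Phi> \<Gamma> n V \<and> mectx_ok \<Phi> \<Gamma> n F"
| "mectx_ok \<Phi> \<Gamma> n (MEReset F) \<longleftrightarrow> mectx_ok \<Phi> \<Gamma> n F"
| "mectx_ok \<Phi> \<Gamma> n (MECtx j F) \<longleftrightarrow> j < length \<Phi> \<and> mectx_ok \<Phi> \<Gamma> n F"

abbreviation closed_mval :: "ectx list \<Rightarrow> val list \<Rightarrow> mval \<Rightarrow> bool" where
  "closed_mval \<Phi> \<Gamma> \<equiv> mval_ok \<Phi> \<Gamma> 0"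
abbreviation closed_mectx :: "ectx list \<Rightarrow> val list \<Rightarrow> mectx \<Rightarrow> bool" where
  "closed_mectx \<Phi> \<Gamma> \<equiv> mectx_ok \<Phi> \<Gamma> 0"

text \<open>The members of \<open>\<Phi>\<close> and \<open>\<Gamma>\<close> are closed whenever these functions are used, so nothing has
  to be lifted under binders.\<close>

primrec mctx_fill :: "ectx list \<Rightarrow> val list \<Rightarrow> mctx \<Rightarrow> trm"
  and mval_fill :: "ectx list \<Rightarrow> val list \<Rightarrow> mval \<Rightarrow> val" where
  "mctx_fill \<Phi> \<Gamma> (MVal V) = Val (mval_fill \<Phi> \<Gamma> V)"
| "mctx_fill \<Phi> \<Gamma> (MApp C D) = App (mctx_fill \<Phi> \<Gamma> C) (mctx_fill \<Phi> \<Gamma> D)"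
| "mctx_fill \<Phi> \<Gamma> (MReset C) = Reset (mctx_fill \<Phi> \<Gamma> C)"
| "mctx_fill \<Phi> \<Gamma> (MShift C) = Shift (mctx_fill \<Phi> \<Gamma> C)"
| "mctx_fill \<Phi> \<Gamma> (MCtx j C) = eplug (\<Phi> ! j) (mctx_fill \<Phi> \<Gamma> C)"
| "mval_fill \<Phi> \<Gamma> (MVar i) = Var i"
| "mval_fill \<Phi> \<Gamma> (MLam C) = Lam (mctx_fill \<Phi> \<Gamma> C)"
| "mval_fill \<Phi> \<Gamma> (MHole i) = \<Gamma> ! i"

text \<open>\<open>\<F>[\<Phi>;\<Gamma>]\<close> as an evaluation context; \<open>\<F>[t;\<Phi>;\<Gamma>]\<close> is
  \<open>eplug (mectx_fill \<Phi> \<Gamma> \<F>) t\<close>.\<close>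

primrec mectx_fill :: "ectx list \<Rightarrow> val list \<Rightarrow> mectx \<Rightarrow> ectx" where
  "mectx_fill \<Phi> \<Gamma> MEHole = EHole"
| "mectx_fill \<Phi> \<Gamma> (MEAppL F C) = EAppL (mectx_fill \<Phi> \<Gamma> F) (mctx_fill \<Phi> \<Gamma> C)"
| "mectx_fill \<Phi> \<Gamma> (MEAppR V F) = EAppR (mval_fill \<Phi> \<Gamma> V) (mectx_fill \<Phi> \<Gamma> F)"
| "mectx_fill \<Phi> \<Gamma> (MEReset F) = EReset (mectx_fill \<Phi> \<Gamma> F)"
| "mectx_fill \<Phi> \<Gamma> (MECtx j F) = ecomp (\<Phi> ! j) (mectx_fill \<Phi> \<Gamma> F)"

definition delimited :: "ectx \<Rightarrow> bool" where
  "delimited F \<longleftrightarrow> (\<exists>F'. F = EReset F')"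

section \<open>Bisimulations\<close>

definition weak_trans :: "('s \<Rightarrow> 'l \<Rightarrow> 's \<Rightarrow> bool) \<Rightarrow> 'l \<Rightarrow> 's \<Rightarrow> 'l \<Rightarrow> 's \<Rightarrow> bool" where
  "weak_trans step \<tau> s \<alpha> s' \<longleftrightarrow>
     (let taus = (\<lambda>s s'. step s \<tau> s')\<^sup>*\<^sup>* in
      if \<alpha> = \<tau> then taus s s'
      else (\<exists>s1 s2. taus s s1 \<and> step s1 \<alpha> s2 \<and> taus s2 s'))"

definition bisimulation ::
  "'s set \<Rightarrow> ('s \<Rightarrow> 'l \<Rightarrow> 's \<Rightarrow> bool) \<Rightarrow> 'l \<Rightarrow> ('s \<Rightarrow> 's \<Rightarrow> bool) \<Rightarrow> bool" where
  "bisimulation States step \<tau> R \<longleftrightarrow>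
     (\<forall>s s'. R s s' \<longrightarrow> s \<in> States \<and> s' \<in> States \<and>
        (\<forall>\<alpha> s1. step s \<alpha> s1 \<longrightarrow> (\<exists>s1'. weak_trans step \<tau> s' \<alpha> s1' \<and> R s1 s1')) \<and>
        (\<forall>\<alpha> s1'. step s' \<alpha> s1' \<longrightarrow> (\<exists>s1. weak_trans step \<tau> s \<alpha> s1 \<and> R s1 s1')))"

definition bisimilar ::
  "'s set \<Rightarrow> ('s \<Rightarrow> 'l \<Rightarrow> 's \<Rightarrow> bool) \<Rightarrow> 'l \<Rightarrow> 's \<Rightarrow> 's \<Rightarrow> bool" where
  "bisimilar States step \<tau> s s' \<longleftrightarrow> (\<exists>R. bisimulation States step \<tau> R \<and> R s s')"

lemma bisimulation_bisimilar: "bisimulation States step \<tau> (bisimilar States step \<tau>)"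
  unfolding bisimulation_def[of _ _ _ "bisimilar States step \<tau>"]
proof (intro allI impI)
  fix s s'
  assume "bisimilar States step \<tau> s s'"
  then obtain R where R: "bisimulation States step \<tau> R" "R s s'"
    unfolding bisimilar_def by blast
  then have sub: "bisimilar States step \<tau> u u'" if "R u u'" for u u'
    using that unfolding bisimilar_def by blast
  show "s \<in> States \<and> s' \<in> States \<and>
        (\<forall>\<alpha> s1. step s \<alpha> s1 \<longrightarrow>
          (\<exists>s1'. weak_trans step \<tau> s' \<alpha> s1' \<and> bisimilar States step \<tau> s1 s1')) \<and>
        (\<forall>\<alpha> s1'. step s' \<alpha> s1' \<longrightarrow>
          (\<exists>s1. weak_trans step \<tau> s \<alpha> s1 \<and> bisimilar States step \<tau> s1 s1'))"
    using R sub unfolding bisimulation_def by meson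
qed

datatype state = TermSt "ectx list" "val list" trm | EnvSt "ectx list" "val list"

definition closed_env :: "ectx list \<Rightarrow> val list \<Rightarrow> bool" where
  "closed_env \<Phi> \<Gamma> \<longleftrightarrow> (\<forall>F \<in> set \<Phi>. closed_ectx F) \<and> (\<forall>v \<in> set \<Gamma>. closed_val v)"

section \<open>The relaxed LTS\<close>

definition states :: "state set" where
  "states = {TermSt \<Phi> \<Gamma> t | \<Phi> \<Gamma> t. closed_env \<Phi> \<Gamma> \<and> closed_trm t}
          \<union> {EnvSt \<Phi> \<Gamma> | \<Phi> \<Gamma>. closed_env \<Phi> \<Gamma>}"

datatype label =
    LTau
  | LLam nat mval
  | LVal
  | LStuck mectx
  | LCtx nat mval
  | LPure nat
  | LSplit nat

inductive rstep :: "state \<Rightarrow> label \<Rightarrow> state \<Rightarrow> bool" where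
  r_tau: "red t t' \<Longrightarrow> rstep (TermSt \<Phi> \<Gamma> t) LTau (TermSt \<Phi> \<Gamma> t')"
| r_lam: "\<lbrakk>i < length \<Gamma>; \<Gamma> ! i = Lam t; closed_mval \<Phi> \<Gamma> V\<rbrakk> \<Longrightarrow>
    rstep (EnvSt \<Phi> \<Gamma>) (LLam i V) (TermSt \<Phi> \<Gamma> (subst_trm 0 (mval_fill \<Phi> \<Gamma> V) t))"
| r_val: "rstep (TermSt \<Phi> \<Gamma> (Val v)) LVal (EnvSt \<Phi> (\<Gamma> @ [v]))"
| r_stuck: "\<lbrakk>stuck t; closed_mectx \<Phi> \<Gamma> F; red_or_nf (eplug (mectx_fill \<Phi> \<Gamma> F) t) t'\<rbrakk> \<Longrightarrow>
    rstep (TermSt \<Phi> \<Gamma> t) (LStuck F) (TermSt \<Phi> \<Gamma> t')"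
| r_ctx: "\<lbrakk>j < length \<Phi>; closed_mval \<Phi> \<Gamma> V\<rbrakk> \<Longrightarrow>
    rstep (EnvSt \<Phi> \<Gamma>) (LCtx j V) (TermSt \<Phi> \<Gamma> (eplug (\<Phi> ! j) (Val (mval_fill \<Phi> \<Gamma> V))))"
| r_pure: "\<lbrakk>j < length \<Phi>; pure_ectx (\<Phi> ! j)\<rbrakk> \<Longrightarrow>
    rstep (EnvSt \<Phi> \<Gamma>) (LPure j) (EnvSt \<Phi> \<Gamma>)"
| r_split: "\<lbrakk>j < length \<Phi>; \<Phi> ! j = ecomp F (EReset E); pure_ectx E\<rbrakk> \<Longrightarrow>
    rstep (EnvSt \<Phi> \<Gamma>) (LSplit j) (EnvSt (\<Phi> @ [ecomp F (EReset EHole), EReset E]) \<Gamma>)"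

definition env_bisim :: "state \<Rightarrow> state \<Rightarrow> bool" where
  "env_bisim = bisimilar states rstep LTau"

section \<open>The original LTS\<close>

definition pure_trm :: "trm \<Rightarrow> bool" where
  "pure_trm p \<longleftrightarrow> is_value p \<or> (\<exists>t. p = Reset t)"

definition pstates :: "state set" where
  "pstates = {TermSt \<Phi> \<Gamma> p | \<Phi> \<Gamma> p. closed_env \<Phi> \<Gamma> \<and> closed_trm p \<and> pure_trm p}
           \<union> {EnvSt \<Phi> \<Gamma> | \<Phi> \<Gamma>. closed_env \<Phi> \<Gamma>}"

datatype plabel =
    PTau
  | PLam nat mval mectx
  | PVal
  | PCtx nat mval mectx
  | PPure nat
  | PSplit nat

inductive pstep :: "state \<Rightarrow> plabel \<Rightarrow> state \<Rightarrow> bool" where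
  p_tau: "\<lbrakk>pure_trm p; red p p'\<rbrakk> \<Longrightarrow> pstep (TermSt \<Phi> \<Gamma> p) PTau (TermSt \<Phi> \<Gamma> p')"
| p_lam: "\<lbrakk>i < length \<Gamma>; \<Gamma> ! i = Lam t; closed_mval \<Phi> \<Gamma> V; closed_mectx \<Phi> \<Gamma> F;
      delimited (mectx_fill \<Phi> \<Gamma> F)\<rbrakk> \<Longrightarrow>
    pstep (EnvSt \<Phi> \<Gamma>) (PLam i V F)
      (TermSt \<Phi> \<Gamma> (eplug (mectx_fill \<Phi> \<Gamma> F) (subst_trm 0 (mval_fill \<Phi> \<Gamma> V) t)))"
| p_val: "pstep (TermSt \<Phi> \<Gamma> (Val v)) PVal (EnvSt \<Phi> (\<Gamma> @ [v]))"
| p_ctx: "\<lbrakk>j < length \<Phi>; closed_mval \<Phi> \<Gamma> V; closed_mectx \<Phi> \<Gamma> F;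
      delimited (mectx_fill \<Phi> \<Gamma> F)\<rbrakk> \<Longrightarrow>
    pstep (EnvSt \<Phi> \<Gamma>) (PCtx j V F)
      (TermSt \<Phi> \<Gamma> (eplug (mectx_fill \<Phi> \<Gamma> F) (eplug (\<Phi> ! j) (Val (mval_fill \<Phi> \<Gamma> V)))))"
| p_pure: "\<lbrakk>j < length \<Phi>; pure_ectx (\<Phi> ! j)\<rbrakk> \<Longrightarrow>
    pstep (EnvSt \<Phi> \<Gamma>) (PPure j) (EnvSt \<Phi> \<Gamma>)"
| p_split: "\<lbrakk>j < length \<Phi>; \<Phi> ! j = ecomp F (EReset E); pure_ectx E\<rbrakk> \<Longrightarrow>
    pstep (EnvSt \<Phi> \<Gamma>) (PSplit j) (EnvSt (\<Phi> @ [ecomp F (EReset EHole), EReset E]) \<Gamma>)"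

definition env_bisim_p :: "state \<Rightarrow> state \<Rightarrow> bool" where
  "env_bisim_p = bisimilar pstates pstep PTau"

text \<open>The extension of \<open>env_bisim_p\<close> to arbitrary closed terms, which need not be pure.\<close>

definition env_bisim_p_trm :: "trm \<Rightarrow> trm \<Rightarrow> bool" where
  "env_bisim_p_trm t0 t1 \<longleftrightarrow> (\<forall>E. closed_ectx E \<and> pure_ectx E \<longrightarrow>
     env_bisim_p (TermSt [] [] (Reset (eplug E t0))) (TermSt [] [] (Reset (eplug E t1))))"

end

theory Submission
  imports Defs
begin

text \<open>Transitions never add evaluation contexts to an empty sequence \<open>\<Phi>\<close>, so from
  \<open>(\<emptyset>, \<emptyset>, t)\<close> only environments of values matter, and a multi-hole context is an open term whose
  free variables are the holes.

  Soundness: if two environments are bisimilar, then an open term closed by the first one terminates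
  only if the same term closed by the second one does. This is an induction on the number of steps.
  Either the open term reduces by itself, or a variable is applied in evaluation position, which is a
  \<open>\<lambda>\<close>-transition of the environments; a stuck term is handled by the transition labelled with the
  surrounding evaluation context. This covers evaluation contexts around the tested terms.
  For arbitrary contexts, one replaces \<open>t0\<close> by \<open>t1\<close> at the moment when the hole reaches an
  evaluation position.

  Completeness: contextual equivalence, extended to environments by quantifying over all open terms,
  is a bisimulation. The value transition is simulated with the context \<open>(\<lambda>x. C) \<box>\<close>.\<close>

section \<open>Closed terms, lifting and substitution\<close>

text \<open>Bisimilarity enters soundness only as a one-directional simulation, measured by the step
  count of the left program; the right program may take any number of steps, and symmetry is applied
  at the end. The obstacle is the case of a value inside a context: passing to the extended
  environment consumes no step, so the claim on environments must already hold for the same count.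
  One flag \<open>D\<close> serves both semantics. They differ in where the surrounding context
  lives: a relaxed transition returns the bare body of an abstraction, an original one has the
  delimited context in its label. The lambda clause of the simulation therefore leaves open how its
  result splits into a context and related terms. Tested terms need not be values, so value holes
  cannot represent them in arbitrary contexts; this forces a second encoding and a measure finer
  than the step count. In completeness determinism does the work: equivalence is invariant under
  reduction on either side, so silent steps need no answer and successors can be chosen
  freely.\<close>

lemma closed_at_mono:
  "closed_at_trm n t \<Longrightarrow> n \<le> m \<Longrightarrow> closed_at_trm m t"
  "closed_at_val n v \<Longrightarrow> n \<le> m \<Longrightarrow> closed_at_val m v"
  by (induction t and v arbitrary: n m and n m rule: trm.induct val.induct) fastforce+

lemma lift_closed:
  "closed_at_trm n t \<Longrightarrow> n \<le> k \<Longrightarrow> lift_trm k t = t"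
  "closed_at_val n v \<Longrightarrow> n \<le> k \<Longrightarrow> lift_val k v = v"
  by (induction t and v arbitrary: n k and n k rule: trm.induct val.induct) fastforce+

lemma subst_closed:
  "closed_at_trm n t \<Longrightarrow> n \<le> k \<Longrightarrow> subst_trm k w t = t"
  "closed_at_val n v \<Longrightarrow> n \<le> k \<Longrightarrow> subst_val k w v = v"
  by (induction t and v arbitrary: n k w and n k w rule: trm.induct val.induct) fastforce+

lemma closed_at_lift:
  "closed_at_trm n t \<Longrightarrow> closed_at_trm (Suc n) (lift_trm k t)"
  "closed_at_val n v \<Longrightarrow> closed_at_val (Suc n) (lift_val k v)"
  by (induction t and v arbitrary: n k and n k rule: trm.induct val.induct) auto

lemma closed_at_subst:
  "closed_at_trm (Suc n) t \<Longrightarrow> closed_at_val n w \<Longrightarrow> k \<le> n \<Longrightarrow> closed_at_trm n (subst_trm k w t)"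
  "closed_at_val (Suc n) v \<Longrightarrow> closed_at_val n w \<Longrightarrow> k \<le> n \<Longrightarrow> closed_at_val n (subst_val k w v)"
  by (induction t and v arbitrary: n k w and n k w rule: trm.induct val.induct) (auto simp: closed_at_lift)

lemma closed_at_eplug [simp]:
  "closed_at_trm n (eplug F t) \<longleftrightarrow> closed_at_ectx n F \<and> closed_at_trm n t"
  by (induction F) auto

lemma closed_at_ectx_lift: "closed_at_ectx n F \<Longrightarrow> closed_at_ectx (Suc n) (lift_ectx k F)"
  by (induction F) (auto simp: closed_at_lift)

lemma closed_at_ectx_ecomp [simp]:
  "closed_at_ectx n (ecomp F G) \<longleftrightarrow> closed_at_ectx n F \<and> closed_at_ectx n G"
  by (induction F) auto

lemma eplug_ecomp: "eplug (ecomp F G) t = eplug F (eplug G t)"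
  by (induction F) auto

lemma eplug_not_value: "\<not> is_value t \<Longrightarrow> eplug F t \<noteq> Val v"
  by (cases F) (auto simp: is_value_def)

lemma closed_at_reify: "closed_at_ectx n E \<Longrightarrow> closed_at_val n (reify E)"
  by (simp add: reify_def closed_at_ectx_lift)

lemma closed_val_Lam:
  assumes "closed_val v"
  obtains b where "v = Lam b"
  using assms by (cases v) auto

lemma red_closed_at: "red t t' \<Longrightarrow> closed_at_trm n t \<Longrightarrow> closed_at_trm n t'"
  by (induction rule: red.induct) (auto intro: closed_at_subst closed_at_reify)

lemma reds_closed_at: "red\<^sup>*\<^sup>* t t' \<Longrightarrow> closed_at_trm n t \<Longrightarrow> closed_at_trm n t'"
  by (induction rule: rtranclp_induct) (auto intro: red_closed_at)

section \<open>Decomposition of terms\<close>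

lemma red_eplug: "red t t' \<Longrightarrow> red (eplug G t) (eplug G t')"
  by (induction rule: red.induct) (metis eplug_ecomp red.intros)+

lemma reds_eplug: "red\<^sup>*\<^sup>* t t' \<Longrightarrow> red\<^sup>*\<^sup>* (eplug G t) (eplug G t')"
  by (induction rule: rtranclp_induct) (auto intro: rtranclp.rtrancl_into_rtrancl red_eplug)

text \<open>An open term can also be blocked by a free variable in function position (\<open>OVar\<close>); for
  terms that encode multi-hole contexts this is the case where a hole has to be consulted.\<close>

datatype outcome = OVal val | OStuck ectx trm | OStep trm | OVar ectx nat val

primrec decompose :: "trm \<Rightarrow> outcome" where
  "decompose (Val v) = OVal v"
| "decompose (Shift t) = OStuck EHole t"
| "decompose (Reset t) = (case decompose t of
      OVal v \<Rightarrow> OStep (Val v)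
    | OStuck E u \<Rightarrow> OStep (Reset (subst_trm 0 (reify E) u))
    | OStep t' \<Rightarrow> OStep (Reset t')
    | OVar F i w \<Rightarrow> OVar (EReset F) i w)"
| "decompose (App t u) = (case decompose t of
      OVal v \<Rightarrow> (case decompose u of
          OVal w \<Rightarrow> (case v of Lam b \<Rightarrow> OStep (subst_trm 0 w b) | Var i \<Rightarrow> OVar EHole i w)
        | OStuck E b \<Rightarrow> OStuck (EAppR v E) b
        | OStep u' \<Rightarrow> OStep (App (Val v) u')
        | OVar F i w \<Rightarrow> OVar (EAppR v F) i w)
    | OStuck E b \<Rightarrow> OStuck (EAppL E u) b
    | OStep t' \<Rightarrow> OStep (App t' u)
    | OVar F i w \<Rightarrow> OVar (EAppL F u) i w)"

lemma decompose_sound: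
  "case decompose t of
      OVal v \<Rightarrow> t = Val v
    | OStuck E u \<Rightarrow> pure_ectx E \<and> t = eplug E (Shift u)
    | OStep t' \<Rightarrow> red t t'
    | OVar F i w \<Rightarrow> t = eplug F (App (Val (Var i)) (Val w))"
proof (induction t rule: trm.induct[where ?P2.0 = "\<lambda>_. True"])
  case (App t u)
  then show ?case
    using red_beta[of EHole] red_eplug[of t _ "EAppL EHole u"] red_eplug[of u _ "EAppR _ EHole"]
    by (auto split: outcome.splits val.splits)
next
  case (Reset t)
  then show ?case
    using red_shift[of _ EHole] red_reset[of EHole] red_eplug[of t _ "EReset EHole"]
    by (auto split: outcome.splits)
qed auto

lemma decompose_eplug_OStep: "decompose r = OStep r' \<Longrightarrow> decompose (eplug F r) = OStep (eplug F r')"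
  by (induction F) auto

lemma decompose_eplug_Shift: "pure_ectx E \<Longrightarrow> decompose (eplug E (Shift u)) = OStuck E u"
  by (induction E) auto

text \<open>Reduction is the graph of a partial function, hence deterministic. Since the
  constructors of \<open>outcome\<close> are disjoint, values, control-stuck terms and reducible
  terms exclude one another by computation.\<close>

lemma red_iff_decompose: "red t t' \<longleftrightarrow> decompose t = OStep t'"
proof
  show "red t t' \<Longrightarrow> decompose t = OStep t'"
    by (induction rule: red.induct)
      (auto intro!: decompose_eplug_OStep simp: decompose_eplug_Shift)
  show "decompose t = OStep t' \<Longrightarrow> red t t'"
    using decompose_sound[of t] by simp
qed

lemma red_deterministic: "red t t1 \<Longrightarrow> red t t2 \<Longrightarrow> t1 = t2"
  by (simp add: red_iff_decompose)

lemma is_value_iff_decompose: "is_value t \<longleftrightarrow> (\<exists>v. decompose t = OVal v)"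
  using decompose_sound[of t] by (auto simp: is_value_def)

lemma control_stuck_iff_decompose: "control_stuck t \<longleftrightarrow> (\<exists>E u. decompose t = OStuck E u)"
proof
  show "control_stuck t \<Longrightarrow> \<exists>E u. decompose t = OStuck E u"
    unfolding control_stuck_def using decompose_eplug_Shift by blast
  show "\<exists>E u. decompose t = OStuck E u \<Longrightarrow> control_stuck t"
    unfolding control_stuck_def using decompose_sound[of t] by force
qed

lemma decompose_closed: "closed_trm t \<Longrightarrow> decompose t \<noteq> OVar F i w"
  using decompose_sound[of t] by auto

lemma control_stuck_imp_stuck: "control_stuck t \<Longrightarrow> stuck t"
  by (auto simp: control_stuck_iff_decompose stuck_def is_value_iff_decompose red_iff_decompose)

text \<open>A closed term has no free variable to block it, so \<open>OVar\<close> is impossible and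
  only an exposed \<open>Shift\<close> remains as a cause of being stuck.\<close>

lemma stuck_iff_control_stuck: "closed_trm t \<Longrightarrow> stuck t \<longleftrightarrow> control_stuck t"
  using decompose_closed[of t]
  by (cases "decompose t")
    (auto simp: control_stuck_iff_decompose stuck_def is_value_iff_decompose red_iff_decompose)

lemma ex_red_or_nf: "\<exists>s'. red_or_nf s s'"
  by (auto simp: red_or_nf_def normal_form_def stuck_def)

lemma pure_trm_red: "pure_trm p \<Longrightarrow> red p p' \<Longrightarrow> pure_trm p'"
  by (auto simp: pure_trm_def red_iff_decompose is_value_def split: outcome.splits)

lemma pure_trm_reds: "red\<^sup>*\<^sup>* p p' \<Longrightarrow> pure_trm p \<Longrightarrow> pure_trm p'"
  by (induction rule: rtranclp_induct) (auto intro: pure_trm_red)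

text \<open>A delimiter at the root handles every exposed \<open>Shift\<close>. This makes the stuck
  clauses of the simulation vacuous for the original LTS.\<close>

lemma pure_trm_not_control_stuck: "pure_trm p \<Longrightarrow> \<not> control_stuck p"
  by (auto simp: pure_trm_def control_stuck_iff_decompose is_value_def split: outcome.splits)

lemma pure_trm_eplug_App: "pure_trm (eplug F (App t u)) \<longleftrightarrow> delimited F"
  by (cases F) (auto simp: pure_trm_def is_value_def delimited_def)

lemma delimited_pure_trm: "delimited F \<Longrightarrow> pure_trm (eplug F t)"
  by (auto simp: pure_trm_def delimited_def)

section \<open>Termination in a number of steps\<close>

text \<open>The explicit count is the induction measure; \<open>halts\<close> forgets it because the
  program compared with may need a different number of steps.\<close>

primrec halts_in :: "(trm \<Rightarrow> bool) \<Rightarrow> nat \<Rightarrow> trm \<Rightarrow> bool" where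
  "halts_in P 0 t \<longleftrightarrow> P t"
| "halts_in P (Suc n) t \<longleftrightarrow> (\<exists>t'. red t t' \<and> halts_in P n t')"

definition halts :: "(trm \<Rightarrow> bool) \<Rightarrow> trm \<Rightarrow> bool" where
  "halts P t \<longleftrightarrow> (\<exists>n. halts_in P n t)"

definition observable :: "(trm \<Rightarrow> bool) \<Rightarrow> bool" where
  "observable P \<longleftrightarrow> P = is_value \<or> P = control_stuck"

lemma observable_not_red: "observable P \<Longrightarrow> P t \<Longrightarrow> \<not> red t t'"
  by (auto simp: observable_def red_iff_decompose is_value_iff_decompose control_stuck_iff_decompose)

text \<open>An observable term does not reduce, which excludes count 0, and by determinism the
  counted run must start with the given step.\<close>

lemma halts_in_red:
  assumes "observable P" "halts_in P n t" "red t t'"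
  obtains m where "n = Suc m" "halts_in P m t'"
  using assms by (cases n) (auto dest: red_deterministic observable_not_red)

lemma halts_red: "observable P \<Longrightarrow> red t t' \<Longrightarrow> halts P t \<longleftrightarrow> halts P t'"
  unfolding halts_def by (meson halts_in.simps(2) halts_in_red)

lemma halts_reds: "red\<^sup>*\<^sup>* t t' \<Longrightarrow> observable P \<Longrightarrow> halts P t \<longleftrightarrow> halts P t'"
  by (induction rule: rtranclp_induct) (auto simp: halts_red)

lemma halts_iff: "halts P t \<longleftrightarrow> (\<exists>t'. red\<^sup>*\<^sup>* t t' \<and> P t')"
proof
  have "\<exists>t'. red\<^sup>*\<^sup>* t t' \<and> P t'" if "halts_in P n t" for n
    using that by (induction n arbitrary: t) (auto, meson converse_rtranclp_into_rtranclp)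
  then show "halts P t \<Longrightarrow> \<exists>t'. red\<^sup>*\<^sup>* t t' \<and> P t'"
    by (auto simp: halts_def)
  have "\<exists>n. halts_in P n t" if "red\<^sup>*\<^sup>* t t'" "P t'" for t'
    using that by (induction rule: converse_rtranclp_induct) (meson halts_in.simps)+
  then show "\<exists>t'. red\<^sup>*\<^sup>* t t' \<and> P t' \<Longrightarrow> halts P t"
    by (auto simp: halts_def)
qed

lemma halts_of_nf: "P t \<Longrightarrow> halts P t"
  by (auto simp: halts_iff)

lemma evaluates_to_value_iff: "evaluates_to_value t \<longleftrightarrow> halts is_value t"
  by (auto simp: evaluates_to_value_def evaluates_def halts_iff normal_form_def)

lemma evaluates_to_control_stuck_iff: "evaluates_to_control_stuck t \<longleftrightarrow> halts control_stuck t"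
  by (auto simp: evaluates_to_control_stuck_def evaluates_def halts_iff normal_form_def
      control_stuck_imp_stuck)

text \<open>A value does not reduce, so the run is empty and \<open>P\<close> can only be
  \<open>is_value\<close>, which every value satisfies.\<close>

lemma observable_Val: "observable P \<Longrightarrow> halts_in P n (Val v) \<Longrightarrow> halts P (Val w)"
  by (cases n) (auto simp: observable_def is_value_def control_stuck_iff_decompose red_iff_decompose
      intro!: halts_of_nf)

lemma observable_Shift:
  assumes "observable P" "halts_in P n (eplug E (Shift u))" "pure_ectx E" "pure_ectx E'"
  shows "halts P (eplug E' (Shift u'))"
proof -
  have "P (eplug E (Shift u))"
    using assms(2,3) by (cases n) (auto simp: red_iff_decompose decompose_eplug_Shift)
  then show ?thesis
    using assms(1,3,4) by (auto simp: observable_def is_value_iff_decompose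
        control_stuck_iff_decompose decompose_eplug_Shift intro!: halts_of_nf)
qed

section \<open>Closing substitutions\<close>

text \<open>\<open>psub_trm d \<rho> t\<close> replaces index \<open>d + i\<close> by the closed value \<open>\<rho> ! i\<close>. For an empty sequence of
  evaluation contexts, a multi-hole context with value holes is the same thing as a term whose
  free variables are the holes. Reversing \<open>\<Gamma>\<close> turns its extension at the end into \<open>Cons\<close> on \<open>\<rho>\<close>.\<close>

primrec psub_trm :: "nat \<Rightarrow> val list \<Rightarrow> trm \<Rightarrow> trm"
  and psub_val :: "nat \<Rightarrow> val list \<Rightarrow> val \<Rightarrow> val" where
  "psub_trm d \<rho> (Val v) = Val (psub_val d \<rho> v)"
| "psub_trm d \<rho> (App t u) = App (psub_trm d \<rho> t) (psub_trm d \<rho> u)"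
| "psub_trm d \<rho> (Shift t) = Shift (psub_trm (Suc d) \<rho> t)"
| "psub_trm d \<rho> (Reset t) = Reset (psub_trm d \<rho> t)"
| "psub_val d \<rho> (Var i) = (if i < d then Var i else \<rho> ! (i - d))"
| "psub_val d \<rho> (Lam t) = Lam (psub_trm (Suc d) \<rho> t)"

primrec psub_ectx :: "nat \<Rightarrow> val list \<Rightarrow> ectx \<Rightarrow> ectx" where
  "psub_ectx d \<rho> EHole = EHole"
| "psub_ectx d \<rho> (EAppR v F) = EAppR (psub_val d \<rho> v) (psub_ectx d \<rho> F)"
| "psub_ectx d \<rho> (EAppL F t) = EAppL (psub_ectx d \<rho> F) (psub_trm d \<rho> t)"
| "psub_ectx d \<rho> (EReset F) = EReset (psub_ectx d \<rho> F)"

lemma psub_eplug [simp]: "psub_trm d \<rho> (eplug F t) = eplug (psub_ectx d \<rho> F) (psub_trm d \<rho> t)"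
  by (induction F) auto

lemma psub_ecomp [simp]: "psub_ectx d \<rho> (ecomp F G) = ecomp (psub_ectx d \<rho> F) (psub_ectx d \<rho> G)"
  by (induction F) auto

lemma pure_psub_ectx [simp]: "pure_ectx (psub_ectx d \<rho> F) \<longleftrightarrow> pure_ectx F"
  by (induction F) auto

lemma delimited_psub_ectx [simp]: "delimited (psub_ectx d \<rho> F) \<longleftrightarrow> delimited F"
  by (cases F) (auto simp: delimited_def)

lemma psub_closed_at:
  "closed_at_trm n t \<Longrightarrow> n \<le> d \<Longrightarrow> psub_trm d \<rho> t = t"
  "closed_at_val n v \<Longrightarrow> n \<le> d \<Longrightarrow> psub_val d \<rho> v = v"
  by (induction t and v arbitrary: n d and n d rule: trm.induct val.induct) fastforce+

lemma psub_ectx_closed_at: "closed_at_ectx n F \<Longrightarrow> n \<le> d \<Longrightarrow> psub_ectx d \<rho> F = F"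
  by (induction F) (auto simp: psub_closed_at)

lemma closed_at_psub:
  assumes "\<And>v. v \<in> set \<rho> \<Longrightarrow> closed_val v"
  shows "closed_at_trm (d + length \<rho>) t \<Longrightarrow> closed_at_trm d (psub_trm d \<rho> t)"
    and "closed_at_val (d + length \<rho>) v \<Longrightarrow> closed_at_val d (psub_val d \<rho> v)"
  by (induction t and v arbitrary: d and d rule: trm.induct val.induct)
    (auto intro!: closed_at_mono(2)[where n = 0] assms)

lemma closed_at_psub_ectx:
  assumes "\<And>v. v \<in> set \<rho> \<Longrightarrow> closed_val v"
  shows "closed_at_ectx (d + length \<rho>) F \<Longrightarrow> closed_at_ectx d (psub_ectx d \<rho> F)"
  by (induction F) (auto simp: closed_at_psub assms)

text \<open>Out-of-range indices would make \<open>\<rho> ! i\<close> arbitrary, hence the bound on the free variables.\<close>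

lemma psub_lift:
  assumes "\<And>v. v \<in> set \<rho> \<Longrightarrow> closed_val v"
  shows "closed_at_trm (d + length \<rho>) t \<Longrightarrow> k \<le> d \<Longrightarrow>
      psub_trm (Suc d) \<rho> (lift_trm k t) = lift_trm k (psub_trm d \<rho> t)"
    and "closed_at_val (d + length \<rho>) v \<Longrightarrow> k \<le> d \<Longrightarrow>
      psub_val (Suc d) \<rho> (lift_val k v) = lift_val k (psub_val d \<rho> v)"
  by (induction t and v arbitrary: d k and d k rule: trm.induct val.induct)
    (auto simp: lift_closed(2)[where n = 0] assms)

lemma psub_lift_ectx:
  assumes "\<And>v. v \<in> set \<rho> \<Longrightarrow> closed_val v"
  shows "closed_at_ectx (d + length \<rho>) F \<Longrightarrow> k \<le> d \<Longrightarrow>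
      psub_ectx (Suc d) \<rho> (lift_ectx k F) = lift_ectx k (psub_ectx d \<rho> F)"
  by (induction F) (auto simp: psub_lift assms)

lemma psub_reify:
  assumes "\<And>v. v \<in> set \<rho> \<Longrightarrow> closed_val v" "closed_at_ectx (d + length \<rho>) E"
  shows "psub_val d \<rho> (reify E) = reify (psub_ectx d \<rho> E)"
  using assms by (simp add: reify_def psub_lift_ectx)

lemma psub_subst:
  assumes "\<And>v. v \<in> set \<rho> \<Longrightarrow> closed_val v"
  shows "closed_at_trm (Suc (d + length \<rho>)) t \<Longrightarrow> closed_at_val (d + length \<rho>) w \<Longrightarrow> k \<le> d \<Longrightarrow>
      psub_trm d \<rho> (subst_trm k w t) = subst_trm k (psub_val d \<rho> w) (psub_trm (Suc d) \<rho> t)"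
    and "closed_at_val (Suc (d + length \<rho>)) v \<Longrightarrow> closed_at_val (d + length \<rho>) w \<Longrightarrow> k \<le> d \<Longrightarrow>
      psub_val d \<rho> (subst_val k w v) = subst_val k (psub_val d \<rho> w) (psub_val (Suc d) \<rho> v)"
  by (induction t and v arbitrary: d k w and d k w rule: trm.induct val.induct)
    (auto simp: subst_closed(2)[where n = 0] assms psub_lift closed_at_lift)

text \<open>Links growth of an environment to beta: applying \<open>Lam t\<close> to
  \<open>w\<close> under \<open>\<rho>\<close> leads to \<open>t\<close> under
  \<open>w # \<rho>\<close>. Thus an evaluation context can observe an extended environment.\<close>

lemma psub_Cons:
  assumes "closed_val w" "\<And>v. v \<in> set \<rho> \<Longrightarrow> closed_val v"
  shows "closed_at_trm (Suc (d + length \<rho>)) t \<Longrightarrow>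
      psub_trm d (w # \<rho>) t = subst_trm d w (psub_trm (Suc d) \<rho> t)"
    and "closed_at_val (Suc (d + length \<rho>)) v \<Longrightarrow>
      psub_val d (w # \<rho>) v = subst_val d w (psub_val (Suc d) \<rho> v)"
  by (induction t and v arbitrary: d and d rule: trm.induct val.induct)
    (auto simp: subst_closed(2)[where n = 0] lift_closed(2)[where n = 0] assms nth_Cons' Suc_diff_Suc)

text \<open>Weakening: a lifted term does not mention the newest value, so a context over the old
  environment can be placed around the new variable.\<close>

lemma psub_Cons_lift:
  "psub_trm d (w # \<rho>) (lift_trm d t) = psub_trm d \<rho> t"
  "psub_val d (w # \<rho>) (lift_val d v) = psub_val d \<rho> v"
  by (induction t and v arbitrary: d and d rule: trm.induct val.induct) (auto simp: Suc_diff_le)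

lemma psub_Cons_lift_ectx: "psub_ectx d (w # \<rho>) (lift_ectx d F) = psub_ectx d \<rho> F"
  by (induction F) (auto simp: psub_Cons_lift)

text \<open>Variables are replaced by values only, so redexes and pure contexts keep their shape.
  The same open step can therefore be run in both environments.\<close>

lemma red_psub:
  assumes "red c c'" "closed_at_trm (length \<rho>) c" "\<And>v. v \<in> set \<rho> \<Longrightarrow> closed_val v"
  shows "red (psub_trm 0 \<rho> c) (psub_trm 0 \<rho> c')"
  using assms(1,2)
proof cases
  case (red_beta F t v)
  then show ?thesis
    using assms(2,3) red.red_beta by (simp add: psub_subst)
next
  case (red_shift E F t)
  then show ?thesis
    using assms(2,3) red.red_shift[of "psub_ectx 0 \<rho> E" "psub_ectx 0 \<rho> F"]
    by (simp add: psub_subst psub_reify closed_at_reify)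
next
  case (red_reset F v)
  then show ?thesis
    using red.red_reset by simp
qed

section \<open>Running open terms in related environments\<close>

text \<open>The flag \<open>D\<close> selects the original semantics, in which only delimited programs are observed.\<close>

definition admissible :: "bool \<Rightarrow> ectx \<Rightarrow> bool" where
  "admissible D F \<longleftrightarrow> (D \<longrightarrow> F = EHole \<or> delimited F)"

text \<open>\<open>EB_lam\<close> lets an instance choose \<open>G\<close>: the relaxed LTS relates
  the bodies and keeps \<open>F\<close> outside, the original LTS relates the whole programs.
  \<open>TB_stuck_nf\<close> asks for the conclusion outright, because when the filled context is
  itself stuck no step is consumed and an induction hypothesis would not apply.\<close>

locale environment_simulation =
  fixes D :: bool
    and EB :: "val list \<Rightarrow> val list \<Rightarrow> bool"
    and TB :: "val list \<Rightarrow> trm \<Rightarrow> val list \<Rightarrow> trm \<Rightarrow> bool"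
  assumes EB_closed: "EB \<rho> \<rho>' \<Longrightarrow>
      length \<rho> = length \<rho>' \<and> (\<forall>v \<in> set \<rho>. closed_val v) \<and> (\<forall>v \<in> set \<rho>'. closed_val v)"
    and TB_closed: "TB \<rho> t \<rho>' t' \<Longrightarrow>
      (\<forall>v \<in> set \<rho>. closed_val v) \<and> closed_trm t \<and> (D \<longrightarrow> pure_trm t)"
    and EB_lam: "\<lbrakk>EB \<rho> \<rho>'; i < length \<rho>; \<rho> ! i = Lam b; \<rho>' ! i = Lam b';
        closed_at_val (length \<rho>) w; closed_at_ectx (length \<rho>) F; D \<longrightarrow> delimited F\<rbrakk> \<Longrightarrow>
      \<exists>G r r'. closed_at_ectx (length \<rho>) G \<and> admissible D G \<and> TB \<rho> r \<rho>' r' \<and>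
        eplug (psub_ectx 0 \<rho> F) (subst_trm 0 (psub_val 0 \<rho> w) b) = eplug (psub_ectx 0 \<rho> G) r \<and>
        red\<^sup>*\<^sup>* (eplug (psub_ectx 0 \<rho>' F) (subst_trm 0 (psub_val 0 \<rho>' w) b'))
          (eplug (psub_ectx 0 \<rho>' G) r')"
    and TB_red: "TB \<rho> t \<rho>' t' \<Longrightarrow> red t s \<Longrightarrow> \<exists>s'. red\<^sup>*\<^sup>* t' s' \<and> TB \<rho> s \<rho>' s'"
    and TB_val: "TB \<rho> (Val v) \<rho>' t' \<Longrightarrow> \<exists>v'. red\<^sup>*\<^sup>* t' (Val v') \<and> EB (v # \<rho>) (v' # \<rho>')"
    and TB_stuck_red: "\<lbrakk>TB \<rho> t \<rho>' t'; control_stuck t; closed_at_ectx (length \<rho>) F;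
        red (eplug (psub_ectx 0 \<rho> F) t) s\<rbrakk> \<Longrightarrow>
      \<exists>s'. red\<^sup>*\<^sup>* (eplug (psub_ectx 0 \<rho>' F) t') s' \<and> TB \<rho> s \<rho>' s'"
    and TB_stuck_nf: "\<lbrakk>TB \<rho> t \<rho>' t'; control_stuck t; closed_at_ectx (length \<rho>) F;
        control_stuck (eplug (psub_ectx 0 \<rho> F) t)\<rbrakk> \<Longrightarrow>
      halts control_stuck (eplug (psub_ectx 0 \<rho>' F) t')"
begin

lemma EB_halts_aux:
  assumes P: "observable P" and EB: "EB \<rho> \<rho>'"
    and c: "closed_at_trm (length \<rho>) c" "D \<longrightarrow> pure_trm c" "halts_in P n (psub_trm 0 \<rho> c)"
    and IH_env: "\<And>m c. \<lbrakk>m < n; closed_at_trm (length \<rho>) c; D \<longrightarrow> pure_trm c;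
        halts_in P m (psub_trm 0 \<rho> c)\<rbrakk> \<Longrightarrow> halts P (psub_trm 0 \<rho>' c)"
    and IH_trm: "\<And>m t t' F. \<lbrakk>m < n; TB \<rho> t \<rho>' t'; closed_at_ectx (length \<rho>) F; admissible D F;
        halts_in P m (eplug (psub_ectx 0 \<rho> F) t)\<rbrakk> \<Longrightarrow> halts P (eplug (psub_ectx 0 \<rho>' F) t')"
  shows "halts P (psub_trm 0 \<rho>' c)"
proof -
  have \<rho>: "length \<rho> = length \<rho>'" "\<And>v. v \<in> set \<rho> \<Longrightarrow> closed_val v" "\<And>v. v \<in> set \<rho>' \<Longrightarrow> closed_val v"
    using EB_closed[OF EB] by auto
  show ?thesis
  proof (cases "decompose c")
    case (OVal v)
    then have "c = Val v"
      using decompose_sound[of c] by simp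
    then show ?thesis
      using observable_Val[OF P] c(3) by simp
  next
    case (OStuck E u)
    then have "c = eplug E (Shift u)" "pure_ectx E"
      using decompose_sound[of c] by simp_all
    then show ?thesis
      using observable_Shift[OF P] c(3) by simp
  next
    case (OStep c')
    then have red: "red c c'"
      by (simp add: red_iff_decompose)
    obtain m where m: "n = Suc m" "halts_in P m (psub_trm 0 \<rho> c')"
      using halts_in_red[OF P c(3) red_psub[OF red c(1) \<rho>(2)]] by blast
    have "halts P (psub_trm 0 \<rho>' c')"
      using IH_env[OF _ red_closed_at[OF red c(1)] _ m(2)] m(1) c(2) pure_trm_red[OF _ red] by auto
    moreover have "red (psub_trm 0 \<rho>' c) (psub_trm 0 \<rho>' c')"
      using red_psub[OF red _ \<rho>(3)] c(1) \<rho>(1) by simp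
    ultimately show ?thesis
      by (simp add: halts_red[OF P])
  next
    case (OVar F i w)
    then have c_eq: "c = eplug F (App (Val (Var i)) (Val w))"
      using decompose_sound[of c] by simp
    then have i: "i < length \<rho>" and w: "closed_at_val (length \<rho>) w"
      and F: "closed_at_ectx (length \<rho>) F" "D \<longrightarrow> delimited F"
      using c(1,2) by (auto simp: pure_trm_eplug_App)
    obtain b where b: "\<rho> ! i = Lam b"
      using closed_val_Lam[OF \<rho>(2)] i nth_mem by metis
    obtain b' where b': "\<rho>' ! i = Lam b'"
      using closed_val_Lam[OF \<rho>(3)] i \<rho>(1) nth_mem by metis
    obtain G r r' where G: "closed_at_ectx (length \<rho>) G" "admissible D G" "TB \<rho> r \<rho>' r'"
      and r: "eplug (psub_ectx 0 \<rho> F) (subst_trm 0 (psub_val 0 \<rho> w) b) = eplug (psub_ectx 0 \<rho> G) r"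
      and r': "red\<^sup>*\<^sup>* (eplug (psub_ectx 0 \<rho>' F) (subst_trm 0 (psub_val 0 \<rho>' w) b'))
          (eplug (psub_ectx 0 \<rho>' G) r')"
      using EB_lam[OF EB i b b' w F] by blast
    have "red (psub_trm 0 \<rho> c) (eplug (psub_ectx 0 \<rho> G) r)"
      using red_beta[of "psub_ectx 0 \<rho> F" b "psub_val 0 \<rho> w"] by (simp add: c_eq b flip: r)
    then obtain m where m: "n = Suc m" "halts_in P m (eplug (psub_ectx 0 \<rho> G) r)"
      using halts_in_red[OF P c(3)] by blast
    have "halts P (eplug (psub_ectx 0 \<rho>' G) r')"
      using IH_trm[OF _ G(3,1,2) m(2)] m(1) by simp
    then have "halts P (eplug (psub_ectx 0 \<rho>' F) (subst_trm 0 (psub_val 0 \<rho>' w) b'))"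
      using halts_reds[OF r' P] by simp
    moreover have "red (psub_trm 0 \<rho>' c)
        (eplug (psub_ectx 0 \<rho>' F) (subst_trm 0 (psub_val 0 \<rho>' w) b'))"
      using red_beta[of "psub_ectx 0 \<rho>' F" b' "psub_val 0 \<rho>' w"] by (simp add: c_eq b')
    ultimately show ?thesis
      by (simp add: halts_red[OF P])
  qed
qed

lemma TB_halts_aux:
  assumes P: "observable P" and TB: "TB \<rho> t \<rho>' t'"
    and F: "closed_at_ectx (length \<rho>) F" "admissible D F"
    and halts: "halts_in P n (eplug (psub_ectx 0 \<rho> F) t)"
    and env: "\<And>\<rho> \<rho>' c. \<lbrakk>EB \<rho> \<rho>'; closed_at_trm (length \<rho>) c; D \<longrightarrow> pure_trm c;
        halts_in P n (psub_trm 0 \<rho> c)\<rbrakk> \<Longrightarrow> halts P (psub_trm 0 \<rho>' c)"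
    and IH: "\<And>m t t' F. \<lbrakk>m < n; TB \<rho> t \<rho>' t'; closed_at_ectx (length \<rho>) F; admissible D F;
        halts_in P m (eplug (psub_ectx 0 \<rho> F) t)\<rbrakk> \<Longrightarrow> halts P (eplug (psub_ectx 0 \<rho>' F) t')"
  shows "halts P (eplug (psub_ectx 0 \<rho>' F) t')"
proof (cases "decompose t")
  case (OVal v)
  then have "t = Val v"
    using decompose_sound[of t] by simp
  then obtain v' where v': "red\<^sup>*\<^sup>* t' (Val v')" and EB: "EB (v # \<rho>) (v' # \<rho>')"
    using TB_val TB by blast
  \<comment> \<open>The value becomes index 0 of the extended environment, so the program turns into
    an open term with an unchanged count; \<open>env\<close> is available at that same
    count.\<close>
  let ?c = "eplug (lift_ectx 0 F) (Val (Var 0))"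
  have "D \<longrightarrow> pure_trm ?c"
    using F(2) by (auto simp: admissible_def pure_trm_def is_value_def delimited_def)
  moreover have "closed_at_trm (length (v # \<rho>)) ?c"
    using F(1) by (simp add: closed_at_ectx_lift)
  moreover have "halts_in P n (psub_trm 0 (v # \<rho>) ?c)"
    using halts by (simp add: psub_Cons_lift_ectx \<open>t = Val v\<close>)
  ultimately have "halts P (psub_trm 0 (v' # \<rho>') ?c)"
    using env[OF EB] by blast
  then show ?thesis
    using halts_reds[OF reds_eplug[OF v'] P] by (simp add: psub_Cons_lift_ectx)
next
  case (OStuck E u)
  then have t: "control_stuck t"
    by (simp add: control_stuck_iff_decompose)
  have cl: "closed_trm (eplug (psub_ectx 0 \<rho> F) t)"
    using TB_closed[OF TB] F(1) closed_at_psub_ectx[of \<rho> 0 F] by simp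
  show ?thesis
  proof (cases "decompose (eplug (psub_ectx 0 \<rho> F) t)")
    case (OVal v)
    have "\<not> is_value t"
      using OStuck by (simp add: is_value_iff_decompose)
    then show ?thesis
      using OVal decompose_sound[of "eplug (psub_ectx 0 \<rho> F) t"] eplug_not_value by simp
  next
    case (OStuck E' u')
    then have nf: "control_stuck (eplug (psub_ectx 0 \<rho> F) t)"
      by (simp add: control_stuck_iff_decompose)
    then have "P (eplug (psub_ectx 0 \<rho> F) t)"
      using halts by (cases n) (auto dest: control_stuck_imp_stuck simp: stuck_def)
    then have "P = control_stuck"
      using P OStuck by (auto simp: observable_def is_value_iff_decompose)
    then show ?thesis
      using TB_stuck_nf[OF TB t F(1) nf] by simp
  next
    case (OStep s)
    then have red: "red (eplug (psub_ectx 0 \<rho> F) t) s"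
      by (simp add: red_iff_decompose)
    obtain m where m: "n = Suc m" "halts_in P m s"
      using halts_in_red[OF P halts red] by blast
    obtain s' where s': "red\<^sup>*\<^sup>* (eplug (psub_ectx 0 \<rho>' F) t') s'" "TB \<rho> s \<rho>' s'"
      using TB_stuck_red[OF TB t F(1) red] by blast
    \<comment> \<open>The stuck transition has absorbed \<open>F\<close> into the related terms, so
      the remaining context is empty, and the reduction of the filled context pays for the induction
      hypothesis.\<close>
    have "halts P s'"
      using IH[OF _ s'(2), of m EHole] m by (simp add: admissible_def)
    then show ?thesis
      using halts_reds[OF s'(1) P] by simp
  next
    case (OVar G i w)
    then show ?thesis
      using decompose_closed[OF cl] by simp
  qed
next
  case (OStep s)
  then have red: "red t s"
    by (simp add: red_iff_decompose)
  obtain m where m: "n = Suc m" "halts_in P m (eplug (psub_ectx 0 \<rho> F) s)"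
    using halts_in_red[OF P halts red_eplug[OF red]] by blast
  obtain s' where s': "red\<^sup>*\<^sup>* t' s'" "TB \<rho> s \<rho>' s'"
    using TB_red[OF TB red] by blast
  have "halts P (eplug (psub_ectx 0 \<rho>' F) s')"
    using IH[OF _ s'(2) F m(2)] m(1) by simp
  then show ?thesis
    using halts_reds[OF reds_eplug[OF s'(1)] P] by simp
next
  case (OVar G i w)
  then show ?thesis
    using decompose_closed TB_closed[OF TB] by blast
qed

text \<open>The two claims are mutually dependent but well ordered: at count \<open>n\<close> the
  environment claim uses both claims only below \<open>n\<close>, while the term claim uses the
  environment claim at \<open>n\<close> itself.\<close>

lemma simulation_halts_in:
  assumes P: "observable P"
  shows "(\<forall>\<rho> \<rho>' c. EB \<rho> \<rho>' \<longrightarrow> closed_at_trm (length \<rho>) c \<longrightarrow> (D \<longrightarrow> pure_trm c) \<longrightarrow>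
        halts_in P n (psub_trm 0 \<rho> c) \<longrightarrow> halts P (psub_trm 0 \<rho>' c)) \<and>
      (\<forall>\<rho> t \<rho>' t' F. TB \<rho> t \<rho>' t' \<longrightarrow> closed_at_ectx (length \<rho>) F \<longrightarrow> admissible D F \<longrightarrow>
        halts_in P n (eplug (psub_ectx 0 \<rho> F) t) \<longrightarrow> halts P (eplug (psub_ectx 0 \<rho>' F) t'))"
proof (induction n rule: less_induct)
  case (less n)
  have env: "halts P (psub_trm 0 \<rho>' c)"
    if "EB \<rho> \<rho>'" "closed_at_trm (length \<rho>) c" "D \<longrightarrow> pure_trm c" "halts_in P n (psub_trm 0 \<rho> c)"
    for \<rho> \<rho>' c
    by (rule EB_halts_aux[OF P that]) (use less that(1) in blast)+
  have "halts P (eplug (psub_ectx 0 \<rho>' F) t')"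
    if "TB \<rho> t \<rho>' t'" "closed_at_ectx (length \<rho>) F" "admissible D F"
      "halts_in P n (eplug (psub_ectx 0 \<rho> F) t)"
    for \<rho> t \<rho>' t' F
    by (rule TB_halts_aux[OF P that]) (use less env in blast)+
  with env show ?case
    by blast
qed

lemma TB_halts:
  assumes "observable P" "TB [] t [] t'" "closed_ectx F" "admissible D F" "halts P (eplug F t)"
  shows "halts P (eplug F t')"
  using simulation_halts_in[OF assms(1)] assms(2-5) psub_ectx_closed_at[OF assms(3)]
  unfolding halts_def[of P "eplug F t"] by (metis le0 list.size(3))

end

section \<open>From evaluation contexts to arbitrary contexts\<close>

text \<open>A hole for a closed term, which need not be a value, is represented by the application of a
  free variable to the identity: such an application blocks evaluation exactly when the hole is
  in evaluation position. \<open>hole_ok_trm d\<close> says that index \<open>d\<close> has no other occurrences.\<close>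

abbreviation ident :: val where
  "ident \<equiv> Lam (Val (Var 0))"

text \<open>The hole variable is the outermost one: \<open>d\<close> counts the binders passed and
  larger indices do not occur in the intended terms, so no index is lowered. \<open>T\<close> is not
  lifted either, which is harmless as it is closed in the reduction arguments and gives capturing
  plugging in general.\<close>

primrec tsub_trm :: "trm \<Rightarrow> nat \<Rightarrow> trm \<Rightarrow> trm"
  and tsub_val :: "trm \<Rightarrow> nat \<Rightarrow> val \<Rightarrow> val" where
  "tsub_trm T d (Val v) = Val (tsub_val T d v)"
| "tsub_trm T d (App t u) =
    (if t = Val (Var d) then T else App (tsub_trm T d t) (tsub_trm T d u))"
| "tsub_trm T d (Shift t) = Shift (tsub_trm T (Suc d) t)"
| "tsub_trm T d (Reset t) = Reset (tsub_trm T d t)"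
| "tsub_val T d (Var i) = Var i"
| "tsub_val T d (Lam t) = Lam (tsub_trm T (Suc d) t)"

primrec hole_ok_trm :: "nat \<Rightarrow> trm \<Rightarrow> bool"
  and hole_ok_val :: "nat \<Rightarrow> val \<Rightarrow> bool" where
  "hole_ok_trm d (Val v) \<longleftrightarrow> hole_ok_val d v"
| "hole_ok_trm d (App t u) \<longleftrightarrow>
    (if t = Val (Var d) then u = Val ident else hole_ok_trm d t \<and> hole_ok_trm d u)"
| "hole_ok_trm d (Shift t) \<longleftrightarrow> hole_ok_trm (Suc d) t"
| "hole_ok_trm d (Reset t) \<longleftrightarrow> hole_ok_trm d t"
| "hole_ok_val d (Var i) \<longleftrightarrow> i \<noteq> d"
| "hole_ok_val d (Lam t) \<longleftrightarrow> hole_ok_trm (Suc d) t"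

primrec holes_trm :: "nat \<Rightarrow> trm \<Rightarrow> nat"
  and holes_val :: "nat \<Rightarrow> val \<Rightarrow> nat" where
  "holes_trm d (Val v) = holes_val d v"
| "holes_trm d (App t u) = (if t = Val (Var d) then 1 else holes_trm d t + holes_trm d u)"
| "holes_trm d (Shift t) = holes_trm (Suc d) t"
| "holes_trm d (Reset t) = holes_trm d t"
| "holes_val d (Var i) = 0"
| "holes_val d (Lam t) = holes_trm (Suc d) t"

primrec tsub_ectx :: "trm \<Rightarrow> nat \<Rightarrow> ectx \<Rightarrow> ectx" where
  "tsub_ectx T d EHole = EHole"
| "tsub_ectx T d (EAppR v F) = EAppR (tsub_val T d v) (tsub_ectx T d F)"
| "tsub_ectx T d (EAppL F t) = EAppL (tsub_ectx T d F) (tsub_trm T d t)"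
| "tsub_ectx T d (EReset F) = EReset (tsub_ectx T d F)"

primrec hole_ok_ectx :: "nat \<Rightarrow> ectx \<Rightarrow> bool" where
  "hole_ok_ectx d EHole \<longleftrightarrow> True"
| "hole_ok_ectx d (EAppR v F) \<longleftrightarrow> hole_ok_val d v \<and> hole_ok_ectx d F"
| "hole_ok_ectx d (EAppL F t) \<longleftrightarrow> hole_ok_ectx d F \<and> hole_ok_trm d t"
| "hole_ok_ectx d (EReset F) \<longleftrightarrow> hole_ok_ectx d F"

lemma hole_ok_not_Var: "hole_ok_trm d t \<Longrightarrow> t \<noteq> Val (Var d)"
  by auto

lemma eplug_eq_Val_Var: "eplug F t = Val (Var d) \<longleftrightarrow> F = EHole \<and> t = Val (Var d)"
  by (cases F) auto

text \<open>Values are excluded because \<open>F\<close> may end inside an encoded hole: the plugged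
  term could be the hole variable itself or its argument \<open>ident\<close>, and then the pieces
  are not well formed although the whole is.\<close>

lemma hole_ok_eplug:
  "\<not> is_value t \<Longrightarrow> hole_ok_trm d (eplug F t) \<longleftrightarrow> hole_ok_ectx d F \<and> hole_ok_trm d t"
  by (induction F) (auto simp: eplug_eq_Val_Var eplug_not_value is_value_def)

lemma hole_ok_eplugI: "hole_ok_ectx d F \<Longrightarrow> hole_ok_trm d t \<Longrightarrow> hole_ok_trm d (eplug F t)"
  by (induction F) (auto simp: eplug_eq_Val_Var)

text \<open>If \<open>t\<close> were the hole variable, plugging it to the left of an argument would
  create a hole that \<open>tsub_ectx\<close> does not see.\<close>

lemma tsub_eplug:
  "hole_ok_ectx d F \<Longrightarrow> t \<noteq> Val (Var d) \<Longrightarrow>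
    tsub_trm T d (eplug F t) = eplug (tsub_ectx T d F) (tsub_trm T d t)"
  by (induction F) (auto simp: eplug_eq_Val_Var)

lemma pure_tsub_ectx [simp]: "pure_ectx (tsub_ectx T d F) \<longleftrightarrow> pure_ectx F"
  by (induction F) auto

lemma delimited_tsub_ectx [simp]: "delimited (tsub_ectx T d F) \<longleftrightarrow> delimited F"
  by (cases F) (auto simp: delimited_def)

lemma closed_at_hole:
  "closed_at_trm n t \<Longrightarrow> n \<le> d \<Longrightarrow> tsub_trm T d t = t \<and> hole_ok_trm d t \<and> holes_trm d t = 0"
  "closed_at_val n v \<Longrightarrow> n \<le> d \<Longrightarrow> tsub_val T d v = v \<and> hole_ok_val d v \<and> holes_val d v = 0"
  by (induction t and v arbitrary: n d and n d rule: trm.induct val.induct) fastforce+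

lemma closed_at_tsub:
  assumes "closed_trm T"
  shows "closed_at_trm (Suc d) t \<Longrightarrow> hole_ok_trm d t \<Longrightarrow> closed_at_trm d (tsub_trm T d t)"
    and "closed_at_val (Suc d) v \<Longrightarrow> hole_ok_val d v \<Longrightarrow> closed_at_val d (tsub_val T d v)"
  by (induction t and v arbitrary: d and d rule: trm.induct val.induct)
    (auto intro: closed_at_mono(1)[where n = 0] assms)

lemma closed_at_tsub_ectx:
  assumes "closed_trm T"
  shows "closed_at_ectx (Suc d) F \<Longrightarrow> hole_ok_ectx d F \<Longrightarrow> closed_at_ectx d (tsub_ectx T d F)"
  by (induction F) (auto simp: closed_at_tsub assms)

lemma hole_ok_lift:
  "hole_ok_trm d t \<Longrightarrow> k \<le> d \<Longrightarrow> hole_ok_trm (Suc d) (lift_trm k t)"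
  "hole_ok_val d v \<Longrightarrow> k \<le> d \<Longrightarrow> hole_ok_val (Suc d) (lift_val k v)"
proof (induction t and v arbitrary: d k and d k rule: trm.induct val.induct)
  case (App t u)
  show ?case
  proof (cases "t = Val (Var d)")
    case True
    then show ?thesis
      using App.prems by simp
  next
    case False
    then have "hole_ok_trm (Suc d) (lift_trm k t)" "hole_ok_trm (Suc d) (lift_trm k u)"
      using App by auto
    then show ?thesis
      using hole_ok_not_Var by auto
  qed
qed auto

lemma tsub_lift:
  assumes "closed_trm T"
  shows "hole_ok_trm d t \<Longrightarrow> k \<le> d \<Longrightarrow>
      tsub_trm T (Suc d) (lift_trm k t) = lift_trm k (tsub_trm T d t)"
    and "hole_ok_val d v \<Longrightarrow> k \<le> d \<Longrightarrow>
      tsub_val T (Suc d) (lift_val k v) = lift_val k (tsub_val T d v)"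
proof (induction t and v arbitrary: d k and d k rule: trm.induct val.induct)
  case (App t u)
  show ?case
  proof (cases "t = Val (Var d)")
    case True
    then show ?thesis
      using App.prems by (simp add: lift_closed(1)[OF assms])
  next
    case False
    then have "hole_ok_trm d t" "hole_ok_trm d u"
      using App.prems by auto
    then show ?thesis
      using App False hole_ok_not_Var[OF hole_ok_lift(1)] by simp
  qed
qed auto

lemma hole_ok_lift_ectx: "hole_ok_ectx d F \<Longrightarrow> k \<le> d \<Longrightarrow> hole_ok_ectx (Suc d) (lift_ectx k F)"
  by (induction F) (auto simp: hole_ok_lift)

lemma tsub_lift_ectx:
  "closed_trm T \<Longrightarrow> hole_ok_ectx d F \<Longrightarrow> k \<le> d \<Longrightarrow>
    tsub_ectx T (Suc d) (lift_ectx k F) = lift_ectx k (tsub_ectx T d F)"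
  by (induction F) (auto simp: tsub_lift)

lemma hole_ok_reify: "hole_ok_ectx d E \<Longrightarrow> hole_ok_val d (reify E)"
  by (simp add: reify_def hole_ok_eplugI hole_ok_lift_ectx)

lemma tsub_reify:
  "closed_trm T \<Longrightarrow> hole_ok_ectx d E \<Longrightarrow> tsub_val T d (reify E) = reify (tsub_ectx T d E)"
  by (simp add: reify_def tsub_lift_ectx tsub_eplug hole_ok_lift_ectx)

lemma hole_ok_subst:
  "hole_ok_trm (Suc d) t \<Longrightarrow> hole_ok_val d w \<Longrightarrow> k \<le> d \<Longrightarrow> hole_ok_trm d (subst_trm k w t)"
  "hole_ok_val (Suc d) v \<Longrightarrow> hole_ok_val d w \<Longrightarrow> k \<le> d \<Longrightarrow> hole_ok_val d (subst_val k w v)"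
proof (induction t and v arbitrary: d k w and d k w rule: trm.induct val.induct)
  case (App t u)
  show ?case
  proof (cases "t = Val (Var (Suc d))")
    case True
    then show ?thesis
      using App.prems by simp
  next
    case False
    then have "hole_ok_trm d (subst_trm k w t)" "hole_ok_trm d (subst_trm k w u)"
      using App by auto
    then show ?thesis
      using hole_ok_not_Var by auto
  qed
qed (auto simp: hole_ok_lift)

lemma tsub_subst:
  assumes "closed_trm T"
  shows "hole_ok_trm (Suc d) t \<Longrightarrow> hole_ok_val d w \<Longrightarrow> k \<le> d \<Longrightarrow>
      tsub_trm T d (subst_trm k w t) = subst_trm k (tsub_val T d w) (tsub_trm T (Suc d) t)"
    and "hole_ok_val (Suc d) v \<Longrightarrow> hole_ok_val d w \<Longrightarrow> k \<le> d \<Longrightarrow>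
      tsub_val T d (subst_val k w v) = subst_val k (tsub_val T d w) (tsub_val T (Suc d) v)"
proof (induction t and v arbitrary: d k w and d k w rule: trm.induct val.induct)
  case (App t u)
  show ?case
  proof (cases "t = Val (Var (Suc d))")
    case True
    then show ?thesis
      using App.prems by (simp add: subst_closed(1)[OF assms])
  next
    case False
    then have "hole_ok_trm (Suc d) t" "hole_ok_trm (Suc d) u"
      using App.prems by auto
    moreover from this have "subst_trm k w t \<noteq> Val (Var d)"
      using hole_ok_not_Var[OF hole_ok_subst(1)] App.prems by blast
    ultimately show ?thesis
      using App False by simp
  qed
qed (auto simp: hole_ok_lift tsub_lift assms)

lemma red_hole_ok:
  assumes "red c c'" "hole_ok_trm 0 c"
  shows "hole_ok_trm 0 c'"
  using assms
proof cases
  case (red_reset F v)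
  then show ?thesis
    using assms(2) by (auto simp: hole_ok_eplug is_value_def intro!: hole_ok_eplugI)
qed (auto simp: hole_ok_eplug is_value_def eplug_not_value
    intro!: hole_ok_eplugI hole_ok_subst hole_ok_reify)

text \<open>An encoded hole has a variable in function position and is thus never the redex, so a
  step of \<open>c\<close> persists whatever closed term fills the holes.\<close>

lemma red_tsub:
  assumes "red c c'" "hole_ok_trm 0 c" "closed_trm T"
  shows "red (tsub_trm T 0 c) (tsub_trm T 0 c')"
  using assms(1)
proof cases
  case (red_beta F t v)
  then have *: "hole_ok_ectx 0 F" "hole_ok_trm (Suc 0) t" "hole_ok_val 0 v"
    using assms(2) by (auto simp: hole_ok_eplug is_value_def)
  then have "subst_trm 0 v t \<noteq> Val (Var 0)"
    using hole_ok_not_Var[OF hole_ok_subst(1)] by blast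
  then show ?thesis
    using * assms(3) red.red_beta by (simp add: red_beta tsub_eplug tsub_subst)
next
  case (red_shift E F t)
  then have *: "hole_ok_ectx 0 F" "hole_ok_ectx 0 E" "hole_ok_trm (Suc 0) t"
    using assms(2) by (auto simp: hole_ok_eplug is_value_def)
  then show ?thesis
    using assms(3) red_shift(3) red.red_shift[of "tsub_ectx T 0 E" "tsub_ectx T 0 F"]
    by (simp add: red_shift(1,2) tsub_eplug tsub_subst tsub_reify hole_ok_reify)
next
  case (red_reset F v)
  then have "hole_ok_ectx 0 F" "hole_ok_val 0 v"
    using assms(2) by (auto simp: hole_ok_eplug is_value_def)
  moreover from this have "v \<noteq> Var 0"
    by auto
  ultimately show ?thesis
    using red.red_reset by (simp add: red_reset tsub_eplug)
qed

lemma holes_eplug_less: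
  "hole_ok_ectx 0 F \<Longrightarrow> closed_trm t \<Longrightarrow>
    holes_trm 0 (eplug F t) < holes_trm 0 (eplug F (App (Val (Var 0)) u))"
  by (induction F) (auto simp: eplug_eq_Val_Var closed_at_hole)

text \<open>When the hole comes into evaluation position, that occurrence is frozen to \<open>t0\<close>. This leaves
  the number of steps unchanged but decreases the number of holes.\<close>

lemma ciu_halts_in:
  assumes P: "observable P" and t: "closed_trm t0" "closed_trm t1"
    and ciu: "\<And>F. \<lbrakk>closed_ectx F; D \<longrightarrow> delimited F; halts P (eplug F t0)\<rbrakk> \<Longrightarrow> halts P (eplug F t1)"
  shows "\<lbrakk>closed_at_trm 1 c; hole_ok_trm 0 c; D \<longrightarrow> pure_trm c; halts_in P n (tsub_trm t0 0 c)\<rbrakk> \<Longrightarrow>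
    halts P (tsub_trm t1 0 c)"
proof (induction "(n, holes_trm 0 c)" arbitrary: n c
    rule: wf_induct_rule[OF wf_lex_prod[OF wf_less_than wf_less_than]])
  case (1 n c)
  note c = "1.prems"
  have IH: "halts P (tsub_trm t1 0 c')"
    if "m < n \<or> m = n \<and> holes_trm 0 c' < holes_trm 0 c" "closed_at_trm 1 c'" "hole_ok_trm 0 c'"
      "D \<longrightarrow> pure_trm c'" "halts_in P m (tsub_trm t0 0 c')" for m c'
    by (rule "1.hyps") (use that in auto)
  show ?case
  proof (cases "decompose c")
    case (OVal v)
    then have "c = Val v"
      using decompose_sound[of c] by simp
    then show ?thesis
      using observable_Val[OF P] c(4) by simp
  next
    case (OStuck E u)
    then have "c = eplug E (Shift u)" "pure_ectx E"
      using decompose_sound[of c] by simp_all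
    moreover from this have "hole_ok_ectx 0 E"
      using c(2) by (simp add: hole_ok_eplug is_value_def)
    ultimately show ?thesis
      using observable_Shift[OF P] c(4) by (simp add: tsub_eplug)
  next
    case (OStep c')
    then have red: "red c c'"
      by (simp add: red_iff_decompose)
    obtain m where m: "n = Suc m" "halts_in P m (tsub_trm t0 0 c')"
      using halts_in_red[OF P c(4) red_tsub[OF red c(2) t(1)]] by blast
    have "halts P (tsub_trm t1 0 c')"
      using IH[OF _ red_closed_at[OF red c(1)] red_hole_ok[OF red c(2)] _ m(2)]
        m(1) c(3) pure_trm_red[OF _ red] by auto
    then show ?thesis
      by (simp add: halts_red[OF P red_tsub[OF red c(2) t(2)]])
  next
    case (OVar F i w)
    \<comment> \<open>Index 0 is the only free one allowed by \<open>closed_at_trm 1\<close>, so the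
      blocking variable is the hole.\<close>
    then have c_eq: "c = eplug F (App (Val (Var 0)) (Val w))"
      using decompose_sound[of c] c(1) by auto
    then have F: "hole_ok_ectx 0 F" "closed_at_ectx 1 F" "D \<longrightarrow> delimited F"
      using c(1-3) by (auto simp: hole_ok_eplug is_value_def pure_trm_eplug_App)
    have t_ok: "tsub_trm T 0 t0 = t0" "hole_ok_trm 0 t0" "t0 \<noteq> Val (Var 0)" for T
      using closed_at_hole(1)[OF t(1)] t(1) by auto
    have tsub_F: "tsub_trm T 0 (eplug F t0) = eplug (tsub_ectx T 0 F) t0"
      and tsub_c: "tsub_trm T 0 c = eplug (tsub_ectx T 0 F) T" for T
      using F(1) t_ok by (simp_all add: tsub_eplug c_eq)
    have "halts P (tsub_trm t1 0 (eplug F t0))"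
    proof (rule IH)
      show "n < n \<or> n = n \<and> holes_trm 0 (eplug F t0) < holes_trm 0 c"
        unfolding c_eq using holes_eplug_less[OF F(1) t(1)] by blast
      show "closed_at_trm 1 (eplug F t0)"
        using F(2) closed_at_mono(1)[OF t(1)] by simp
      show "halts_in P n (tsub_trm t0 0 (eplug F t0))"
        using c(4) by (simp add: tsub_F tsub_c)
    qed (use F t_ok in \<open>auto intro: hole_ok_eplugI delimited_pure_trm\<close>)
    then show ?thesis
      using ciu[of "tsub_ectx t1 0 F"] F closed_at_tsub_ectx[OF t(2), of 0 F]
      by (simp add: tsub_F tsub_c)
  qed
qed

primrec hole_ctx :: "nat \<Rightarrow> ctx \<Rightarrow> trm" where
  "hole_ctx d CHole = App (Val (Var d)) (Val ident)"
| "hole_ctx d (CLam C) = Val (Lam (hole_ctx (Suc d) C))"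
| "hole_ctx d (CAppR t C) = App t (hole_ctx d C)"
| "hole_ctx d (CAppL C t) = App (hole_ctx d C) t"
| "hole_ctx d (CShift C) = Shift (hole_ctx (Suc d) C)"
| "hole_ctx d (CReset C) = Reset (hole_ctx d C)"

lemma hole_ctx:
  assumes "closed_at_ctx d C"
  shows "closed_at_trm (Suc d) (hole_ctx d C) \<and> hole_ok_trm d (hole_ctx d C) \<and>
    tsub_trm T d (hole_ctx d C) = cplug C T"
  using assms
proof (induction C arbitrary: d)
  case (CAppR t C)
  then show ?case
    using closed_at_hole(1)[of d t d T] closed_at_mono(1)[of d t "Suc d"] hole_ok_not_Var[of d t]
    by auto
next
  case (CAppL C t)
  then show ?case
    using closed_at_hole(1)[of d t d T] closed_at_mono(1)[of d t "Suc d"]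
      hole_ok_not_Var[of d "hole_ctx d C"]
    by auto
qed auto

lemma ciu_ctx:
  assumes "observable P" "closed_trm t0" "closed_trm t1"
    and "\<And>F. \<lbrakk>closed_ectx F; D \<longrightarrow> delimited F; halts P (eplug F t0)\<rbrakk> \<Longrightarrow> halts P (eplug F t1)"
    and "closed_ctx C" "D \<longrightarrow> (\<exists>C'. C = CReset C')" "halts P (cplug C t0)"
  shows "halts P (cplug C t1)"
proof -
  have "D \<longrightarrow> pure_trm (hole_ctx 0 C)"
    using assms(6) by (auto simp: pure_trm_def)
  then show ?thesis
    using ciu_halts_in[OF assms(1-4), where c = "hole_ctx 0 C"] hole_ctx[OF assms(5)] assms(7)
    unfolding halts_def[of P "cplug C t0"] by auto
qed

section \<open>Multi-hole contexts as open terms\<close>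

text \<open>The translation sees the environment only through its length \<open>n\<close>, so one
  label encodes the same open term for both related environments. The index \<open>n - Suc i\<close>
  undoes the reversal of the value list; the \<open>MCtx\<close> clause is a dummy, since the
  sequence of contexts is empty.\<close>

primrec mctx_to_trm :: "nat \<Rightarrow> nat \<Rightarrow> mctx \<Rightarrow> trm"
  and mval_to_val :: "nat \<Rightarrow> nat \<Rightarrow> mval \<Rightarrow> val" where
  "mctx_to_trm n d (MVal V) = Val (mval_to_val n d V)"
| "mctx_to_trm n d (MApp C C') = App (mctx_to_trm n d C) (mctx_to_trm n d C')"
| "mctx_to_trm n d (MReset C) = Reset (mctx_to_trm n d C)"
| "mctx_to_trm n d (MShift C) = Shift (mctx_to_trm n (Suc d) C)"
| "mctx_to_trm n d (MCtx j C) = mctx_to_trm n d C"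
| "mval_to_val n d (MVar i) = Var i"
| "mval_to_val n d (MLam C) = Lam (mctx_to_trm n (Suc d) C)"
| "mval_to_val n d (MHole i) = Var (d + (n - Suc i))"

primrec mectx_to_ectx :: "nat \<Rightarrow> mectx \<Rightarrow> ectx" where
  "mectx_to_ectx n MEHole = EHole"
| "mectx_to_ectx n (MEAppL F C) = EAppL (mectx_to_ectx n F) (mctx_to_trm n 0 C)"
| "mectx_to_ectx n (MEAppR V F) = EAppR (mval_to_val n 0 V) (mectx_to_ectx n F)"
| "mectx_to_ectx n (MEReset F) = EReset (mectx_to_ectx n F)"
| "mectx_to_ectx n (MECtx j F) = mectx_to_ectx n F"

primrec trm_to_mctx :: "nat \<Rightarrow> nat \<Rightarrow> trm \<Rightarrow> mctx"
  and val_to_mval :: "nat \<Rightarrow> nat \<Rightarrow> val \<Rightarrow> mval" where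
  "trm_to_mctx n d (Val v) = MVal (val_to_mval n d v)"
| "trm_to_mctx n d (App t u) = MApp (trm_to_mctx n d t) (trm_to_mctx n d u)"
| "trm_to_mctx n d (Shift t) = MShift (trm_to_mctx n (Suc d) t)"
| "trm_to_mctx n d (Reset t) = MReset (trm_to_mctx n d t)"
| "val_to_mval n d (Var i) = (if i < d then MVar i else MHole (n - Suc (i - d)))"
| "val_to_mval n d (Lam t) = MLam (trm_to_mctx n (Suc d) t)"

primrec ectx_to_mectx :: "nat \<Rightarrow> ectx \<Rightarrow> mectx" where
  "ectx_to_mectx n EHole = MEHole"
| "ectx_to_mectx n (EAppL F t) = MEAppL (ectx_to_mectx n F) (trm_to_mctx n 0 t)"
| "ectx_to_mectx n (EAppR v F) = MEAppR (val_to_mval n 0 v) (ectx_to_mectx n F)"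
| "ectx_to_mectx n (EReset F) = MEReset (ectx_to_mectx n F)"

lemma mctx_to_trm:
  "mctx_ok [] (rev \<rho>) d C \<Longrightarrow> closed_at_trm (d + length \<rho>) (mctx_to_trm (length \<rho>) d C) \<and>
    mctx_fill [] (rev \<rho>) C = psub_trm d \<rho> (mctx_to_trm (length \<rho>) d C)"
  "mval_ok [] (rev \<rho>) d V \<Longrightarrow> closed_at_val (d + length \<rho>) (mval_to_val (length \<rho>) d V) \<and>
    mval_fill [] (rev \<rho>) V = psub_val d \<rho> (mval_to_val (length \<rho>) d V)"
  by (induction C and V arbitrary: d and d rule: mctx.induct mval.induct)
    (force simp: rev_nth)+

lemma mectx_to_ectx:
  "closed_mectx [] (rev \<rho>) F \<Longrightarrow> closed_at_ectx (length \<rho>) (mectx_to_ectx (length \<rho>) F) \<and>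
    mectx_fill [] (rev \<rho>) F = psub_ectx 0 \<rho> (mectx_to_ectx (length \<rho>) F)"
  using mctx_to_trm[where d = 0] by (induction F) auto

lemma trm_to_mctx:
  "closed_at_trm (d + length \<rho>) t \<Longrightarrow> mctx_ok [] (rev \<rho>) d (trm_to_mctx (length \<rho>) d t) \<and>
    mctx_fill [] (rev \<rho>) (trm_to_mctx (length \<rho>) d t) = psub_trm d \<rho> t"
  "closed_at_val (d + length \<rho>) v \<Longrightarrow> mval_ok [] (rev \<rho>) d (val_to_mval (length \<rho>) d v) \<and>
    mval_fill [] (rev \<rho>) (val_to_mval (length \<rho>) d v) = psub_val d \<rho> v"
  by (induction t and v arbitrary: d and d rule: trm.induct val.induct)
    (force simp: rev_nth)+

lemma ectx_to_mectx:
  "closed_at_ectx (length \<rho>) F \<Longrightarrow> closed_mectx [] (rev \<rho>) (ectx_to_mectx (length \<rho>) F) \<and>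
    mectx_fill [] (rev \<rho>) (ectx_to_mectx (length \<rho>) F) = psub_ectx 0 \<rho> F"
  using trm_to_mctx[where d = 0] by (induction F) auto

section \<open>Bisimilarity\<close>

lemma bisimilar_sym:
  assumes "bisimilar S step \<tau> s s'"
  shows "bisimilar S step \<tau> s' s"
proof -
  obtain R where R: "bisimulation S step \<tau> R" "R s s'"
    using assms by (auto simp: bisimilar_def)
  have "bisimulation S step \<tau> (\<lambda>u u'. R u' u)"
    using R(1) unfolding bisimulation_def by blast
  then show ?thesis
    using R(2) by (auto simp: bisimilar_def)
qed

lemma bisimulation_of_symmetric:
  assumes "\<And>s s'. R s s' \<Longrightarrow> R s' s" "\<And>s s'. R s s' \<Longrightarrow> s \<in> S"
    and "\<And>s s' \<alpha> s1. R s s' \<Longrightarrow> step s \<alpha> s1 \<Longrightarrow> \<exists>s1'. weak_trans step \<tau> s' \<alpha> s1' \<and> R s1 s1'"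
  shows "bisimulation S step \<tau> R"
  unfolding bisimulation_def using assms by meson

lemma bisimilar_states: "bisimilar S step \<tau> s s' \<Longrightarrow> s \<in> S \<and> s' \<in> S"
  using bisimulation_bisimilar[of S step \<tau>] unfolding bisimulation_def by blast

lemma bisimilar_step:
  "bisimilar S step \<tau> s s' \<Longrightarrow> step s \<alpha> s1 \<Longrightarrow>
    \<exists>s1'. weak_trans step \<tau> s' \<alpha> s1' \<and> bisimilar S step \<tau> s1 s1'"
  using bisimulation_bisimilar[of S step \<tau>] unfolding bisimulation_def by blast

lemma weak_trans_tau: "weak_trans step \<tau> s \<tau> s' \<longleftrightarrow> (\<lambda>s s'. step s \<tau> s')\<^sup>*\<^sup>* s s'"
  by (simp add: weak_trans_def)

lemma weak_trans_not_tau: "\<alpha> \<noteq> \<tau> \<Longrightarrow> weak_trans step \<tau> s \<alpha> s' \<longleftrightarrow>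
    (\<exists>s1 s2. (\<lambda>s s'. step s \<tau> s')\<^sup>*\<^sup>* s s1 \<and> step s1 \<alpha> s2 \<and> (\<lambda>s s'. step s \<tau> s')\<^sup>*\<^sup>* s2 s')"
  by (simp add: weak_trans_def Let_def)

inductive_cases rstep_TermE: "rstep (TermSt \<Phi> \<Gamma> t) \<alpha> s"
inductive_cases rstep_EnvE: "rstep (EnvSt \<Phi> \<Gamma>) \<alpha> s"
inductive_cases pstep_TermE: "pstep (TermSt \<Phi> \<Gamma> t) \<alpha> s"
inductive_cases pstep_EnvE: "pstep (EnvSt \<Phi> \<Gamma>) \<alpha> s"

lemma rtaus_Term:
  "(\<lambda>s s'. rstep s LTau s')\<^sup>*\<^sup>* (TermSt \<Phi> \<Gamma> t) s \<longleftrightarrow> (\<exists>t'. s = TermSt \<Phi> \<Gamma> t' \<and> red\<^sup>*\<^sup>* t t')"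
proof
  show "(\<lambda>s s'. rstep s LTau s')\<^sup>*\<^sup>* (TermSt \<Phi> \<Gamma> t) s \<Longrightarrow> \<exists>t'. s = TermSt \<Phi> \<Gamma> t' \<and> red\<^sup>*\<^sup>* t t'"
    by (induction rule: rtranclp_induct)
      (auto elim!: rstep_TermE intro: rtranclp.rtrancl_into_rtrancl)
  have "red\<^sup>*\<^sup>* t t' \<Longrightarrow> (\<lambda>s s'. rstep s LTau s')\<^sup>*\<^sup>* (TermSt \<Phi> \<Gamma> t) (TermSt \<Phi> \<Gamma> t')" for t'
    by (induction rule: rtranclp_induct) (auto intro: rtranclp.rtrancl_into_rtrancl r_tau)
  then show "\<exists>t'. s = TermSt \<Phi> \<Gamma> t' \<and> red\<^sup>*\<^sup>* t t' \<Longrightarrow> (\<lambda>s s'. rstep s LTau s')\<^sup>*\<^sup>* (TermSt \<Phi> \<Gamma> t) s"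
    by blast
qed

lemma rtaus_Env: "(\<lambda>s s'. rstep s LTau s')\<^sup>*\<^sup>* (EnvSt \<Phi> \<Gamma>) s \<longleftrightarrow> s = EnvSt \<Phi> \<Gamma>"
proof -
  have "(\<lambda>s s'. rstep s LTau s')\<^sup>*\<^sup>* (EnvSt \<Phi> \<Gamma>) s \<Longrightarrow> s = EnvSt \<Phi> \<Gamma>"
    by (induction rule: rtranclp_induct) (auto elim!: rstep_EnvE)
  then show ?thesis
    by auto
qed

lemma ptaus_Term:
  assumes "pure_trm t"
  shows "(\<lambda>s s'. pstep s PTau s')\<^sup>*\<^sup>* (TermSt \<Phi> \<Gamma> t) s \<longleftrightarrow> (\<exists>t'. s = TermSt \<Phi> \<Gamma> t' \<and> red\<^sup>*\<^sup>* t t')"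
proof
  show "(\<lambda>s s'. pstep s PTau s')\<^sup>*\<^sup>* (TermSt \<Phi> \<Gamma> t) s \<Longrightarrow> \<exists>t'. s = TermSt \<Phi> \<Gamma> t' \<and> red\<^sup>*\<^sup>* t t'"
    by (induction rule: rtranclp_induct)
      (auto elim!: pstep_TermE intro: rtranclp.rtrancl_into_rtrancl)
  have "red\<^sup>*\<^sup>* t t' \<Longrightarrow> (\<lambda>s s'. pstep s PTau s')\<^sup>*\<^sup>* (TermSt \<Phi> \<Gamma> t) (TermSt \<Phi> \<Gamma> t')" for t'
  proof (induction rule: rtranclp_induct)
    case (step u u')
    then show ?case
      using p_tau[OF pure_trm_reds[OF _ assms]] by (meson rtranclp.rtrancl_into_rtrancl)
  qed simp
  then show "\<exists>t'. s = TermSt \<Phi> \<Gamma> t' \<and> red\<^sup>*\<^sup>* t t' \<Longrightarrow> (\<lambda>s s'. pstep s PTau s')\<^sup>*\<^sup>* (TermSt \<Phi> \<Gamma> t) s"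
    by blast
qed

lemma ptaus_Env: "(\<lambda>s s'. pstep s PTau s')\<^sup>*\<^sup>* (EnvSt \<Phi> \<Gamma>) s \<longleftrightarrow> s = EnvSt \<Phi> \<Gamma>"
proof -
  have "(\<lambda>s s'. pstep s PTau s')\<^sup>*\<^sup>* (EnvSt \<Phi> \<Gamma>) s \<Longrightarrow> s = EnvSt \<Phi> \<Gamma>"
    by (induction rule: rtranclp_induct) (auto elim!: pstep_EnvE)
  then show ?thesis
    by auto
qed

section \<open>Soundness\<close>

definition r_env :: "val list \<Rightarrow> val list \<Rightarrow> bool" where
  "r_env \<rho> \<rho>' \<longleftrightarrow> length \<rho> = length \<rho>' \<and> env_bisim (EnvSt [] (rev \<rho>)) (EnvSt [] (rev \<rho>'))"

definition r_trm :: "val list \<Rightarrow> trm \<Rightarrow> val list \<Rightarrow> trm \<Rightarrow> bool" where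
  "r_trm \<rho> t \<rho>' t' \<longleftrightarrow>
    length \<rho> = length \<rho>' \<and> env_bisim (TermSt [] (rev \<rho>) t) (TermSt [] (rev \<rho>') t')"

definition p_env :: "val list \<Rightarrow> val list \<Rightarrow> bool" where
  "p_env \<rho> \<rho>' \<longleftrightarrow> length \<rho> = length \<rho>' \<and> env_bisim_p (EnvSt [] (rev \<rho>)) (EnvSt [] (rev \<rho>'))"

definition p_trm :: "val list \<Rightarrow> trm \<Rightarrow> val list \<Rightarrow> trm \<Rightarrow> bool" where
  "p_trm \<rho> t \<rho>' t' \<longleftrightarrow>
    length \<rho> = length \<rho>' \<and> env_bisim_p (TermSt [] (rev \<rho>) t) (TermSt [] (rev \<rho>') t')"

lemma env_bisim_states: "env_bisim s s' \<Longrightarrow> s \<in> states \<and> s' \<in> states"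
  by (simp add: env_bisim_def bisimilar_states)

lemma env_bisim_step:
  "env_bisim s s' \<Longrightarrow> rstep s \<alpha> s1 \<Longrightarrow> \<exists>s1'. weak_trans rstep LTau s' \<alpha> s1' \<and> env_bisim s1 s1'"
  unfolding env_bisim_def by (rule bisimilar_step)

lemma env_bisim_p_states: "env_bisim_p s s' \<Longrightarrow> s \<in> pstates \<and> s' \<in> pstates"
  by (simp add: env_bisim_p_def bisimilar_states)

lemma env_bisim_p_step:
  "env_bisim_p s s' \<Longrightarrow> pstep s \<alpha> s1 \<Longrightarrow> \<exists>s1'. weak_trans pstep PTau s' \<alpha> s1' \<and> env_bisim_p s1 s1'"
  unfolding env_bisim_p_def by (rule bisimilar_step)

text \<open>The answer evaluates \<open>t'\<close> to some stuck \<open>u\<close> and then either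
  reduces or repeats the filled context; evaluation inside \<open>F\<close> turns both into a single
  run from the filled \<open>t'\<close>.\<close>

lemma r_trm_stuck:
  assumes "r_trm \<rho> t \<rho>' t'" "control_stuck t" "closed_at_ectx (length \<rho>) F"
    "red_or_nf (eplug (psub_ectx 0 \<rho> F) t) s"
  shows "\<exists>s'. red\<^sup>*\<^sup>* (eplug (psub_ectx 0 \<rho>' F) t') s' \<and> r_trm \<rho> s \<rho>' s'"
proof -
  have len: "length \<rho> = length \<rho>'" and bisim: "env_bisim (TermSt [] (rev \<rho>) t) (TermSt [] (rev \<rho>') t')"
    using assms(1) by (auto simp: r_trm_def)
  let ?F = "ectx_to_mectx (length \<rho>) F"
  have F: "mectx_fill [] (rev \<rho>) ?F = psub_ectx 0 \<rho> F" "mectx_fill [] (rev \<rho>') ?F = psub_ectx 0 \<rho>' F"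
    "closed_mectx [] (rev \<rho>) ?F"
    using ectx_to_mectx[of \<rho> F] ectx_to_mectx[of \<rho>' F] assms(3) len by auto
  have "rstep (TermSt [] (rev \<rho>) t) (LStuck ?F) (TermSt [] (rev \<rho>) s)"
    using r_stuck control_stuck_imp_stuck assms(2,4) F by metis
  then obtain s1 where s1: "weak_trans rstep LTau (TermSt [] (rev \<rho>') t') (LStuck ?F) s1"
    "env_bisim (TermSt [] (rev \<rho>) s) s1"
    using env_bisim_step[OF bisim] by blast
  then obtain u u' s' where u: "red\<^sup>*\<^sup>* t' u" "red_or_nf (eplug (psub_ectx 0 \<rho>' F) u) u'" "red\<^sup>*\<^sup>* u' s'"
    "s1 = TermSt [] (rev \<rho>') s'"
    by (auto simp: weak_trans_not_tau rtaus_Term F elim!: rstep_TermE)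
  have "red\<^sup>*\<^sup>* (eplug (psub_ectx 0 \<rho>' F) u) u'"
    using u(2) by (auto simp: red_or_nf_def)
  then have "red\<^sup>*\<^sup>* (eplug (psub_ectx 0 \<rho>' F) t') s'"
    using reds_eplug[OF u(1)] u(3) by (meson rtranclp_trans)
  then show ?thesis
    using s1(2) u(4) len by (auto simp: r_trm_def)
qed

interpretation relaxed: environment_simulation False r_env r_trm
proof
  fix \<rho> \<rho>'
  assume "r_env \<rho> \<rho>'"
  then show "length \<rho> = length \<rho>' \<and> (\<forall>v \<in> set \<rho>. closed_val v) \<and> (\<forall>v \<in> set \<rho>'. closed_val v)"
    by (auto simp: r_env_def states_def closed_env_def dest!: env_bisim_states)
next
  fix \<rho> t \<rho>' t'
  assume "r_trm \<rho> t \<rho>' t'"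
  then show "(\<forall>v \<in> set \<rho>. closed_val v) \<and> closed_trm t \<and> (False \<longrightarrow> pure_trm t)"
    by (auto simp: r_trm_def states_def closed_env_def dest!: env_bisim_states)
next
  fix \<rho> \<rho>' i b b' w F
  assume env: "r_env \<rho> \<rho>'" and i: "i < length \<rho>" and b: "\<rho> ! i = Lam b" "\<rho>' ! i = Lam b'"
    and w: "closed_at_val (length \<rho>) w" and F: "closed_at_ectx (length \<rho>) F"
  have len: "length \<rho> = length \<rho>'" and bisim: "env_bisim (EnvSt [] (rev \<rho>)) (EnvSt [] (rev \<rho>'))"
    using env by (auto simp: r_env_def)
  let ?i = "length \<rho> - Suc i" and ?V = "val_to_mval (length \<rho>) 0 w"
  have V: "mval_fill [] (rev \<rho>) ?V = psub_val 0 \<rho> w" "mval_fill [] (rev \<rho>') ?V = psub_val 0 \<rho>' w"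
    "closed_mval [] (rev \<rho>) ?V"
    using trm_to_mctx(2)[of 0 \<rho> w] trm_to_mctx(2)[of 0 \<rho>' w] w len by auto
  have nth: "rev \<rho> ! ?i = Lam b" "rev \<rho>' ! ?i = Lam b'" "?i < length (rev \<rho>)"
    using i b len by (auto simp: rev_nth)
  have "rstep (EnvSt [] (rev \<rho>)) (LLam ?i ?V) (TermSt [] (rev \<rho>) (subst_trm 0 (psub_val 0 \<rho> w) b))"
    using r_lam[OF nth(3,1) V(3)] V(1) by simp
  then obtain s where "weak_trans rstep LTau (EnvSt [] (rev \<rho>')) (LLam ?i ?V) s"
    "env_bisim (TermSt [] (rev \<rho>) (subst_trm 0 (psub_val 0 \<rho> w) b)) s"
    using env_bisim_step[OF bisim] by blast
  then obtain r' where r': "red\<^sup>*\<^sup>* (subst_trm 0 (psub_val 0 \<rho>' w) b') r'"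
    "r_trm \<rho> (subst_trm 0 (psub_val 0 \<rho> w) b) \<rho>' r'"
    using nth(2) V(2) len
    by (auto simp: weak_trans_not_tau rtaus_Env rtaus_Term r_trm_def elim!: rstep_EnvE)
  \<comment> \<open>The relaxed label has no context, so the bodies are the related terms and
    \<open>G\<close> is \<open>F\<close>.\<close>
  show "\<exists>G r r'. closed_at_ectx (length \<rho>) G \<and> admissible False G \<and> r_trm \<rho> r \<rho>' r' \<and>
      eplug (psub_ectx 0 \<rho> F) (subst_trm 0 (psub_val 0 \<rho> w) b) = eplug (psub_ectx 0 \<rho> G) r \<and>
      red\<^sup>*\<^sup>* (eplug (psub_ectx 0 \<rho>' F) (subst_trm 0 (psub_val 0 \<rho>' w) b'))
        (eplug (psub_ectx 0 \<rho>' G) r')"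
    by (intro exI conjI, rule F, simp add: admissible_def, rule r', rule refl,
        rule reds_eplug[OF r'(1)])
next
  fix \<rho> t \<rho>' t' s
  assume trm: "r_trm \<rho> t \<rho>' t'" and red: "red t s"
  then have len: "length \<rho> = length \<rho>'"
    and bisim: "env_bisim (TermSt [] (rev \<rho>) t) (TermSt [] (rev \<rho>') t')"
    by (auto simp: r_trm_def)
  show "\<exists>s'. red\<^sup>*\<^sup>* t' s' \<and> r_trm \<rho> s \<rho>' s'"
    using env_bisim_step[OF bisim r_tau[OF red]] len
    by (auto simp: r_trm_def weak_trans_tau rtaus_Term)
next
  fix \<rho> v \<rho>' t'
  assume "r_trm \<rho> (Val v) \<rho>' t'"
  then have len: "length \<rho> = length \<rho>'"
    and bisim: "env_bisim (TermSt [] (rev \<rho>) (Val v)) (TermSt [] (rev \<rho>') t')"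
    by (auto simp: r_trm_def)
  show "\<exists>v'. red\<^sup>*\<^sup>* t' (Val v') \<and> r_env (v # \<rho>) (v' # \<rho>')"
    using env_bisim_step[OF bisim r_val] len
    by (auto simp: weak_trans_not_tau rtaus_Env rtaus_Term r_env_def elim!: rstep_TermE)
next
  fix \<rho> t \<rho>' t' F s
  assume "r_trm \<rho> t \<rho>' t'" "control_stuck t" "closed_at_ectx (length \<rho>) F"
    "red (eplug (psub_ectx 0 \<rho> F) t) s"
  then show "\<exists>s'. red\<^sup>*\<^sup>* (eplug (psub_ectx 0 \<rho>' F) t') s' \<and> r_trm \<rho> s \<rho>' s'"
    by (intro r_trm_stuck) (auto simp: red_or_nf_def)
next
  fix \<rho> t \<rho>' t' F
  assume trm: "r_trm \<rho> t \<rho>' t'" "control_stuck t" "closed_at_ectx (length \<rho>) F"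
    and nf: "control_stuck (eplug (psub_ectx 0 \<rho> F) t)"
  have refl: "red_or_nf (eplug (psub_ectx 0 \<rho> F) t) (eplug (psub_ectx 0 \<rho> F) t)"
    using control_stuck_imp_stuck[OF nf] by (simp add: red_or_nf_def normal_form_def)
  obtain s' where s': "red\<^sup>*\<^sup>* (eplug (psub_ectx 0 \<rho>' F) t') s'"
    "r_trm \<rho> (eplug (psub_ectx 0 \<rho> F) t) \<rho>' s'"
    using r_trm_stuck[OF trm refl] by blast
  then have bisim: "env_bisim (TermSt [] (rev \<rho>) (eplug (psub_ectx 0 \<rho> F) t)) (TermSt [] (rev \<rho>') s')"
    by (simp add: r_trm_def)
  \<comment> \<open>The first answer only gives a bisimilar \<open>s'\<close>, which need not be
    stuck yet. A second stuck transition, with the empty context, forces \<open>s'\<close> to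
    evaluate to a stuck term.\<close>
  have "rstep (TermSt [] (rev \<rho>) (eplug (psub_ectx 0 \<rho> F) t)) (LStuck MEHole)
      (TermSt [] (rev \<rho>) (eplug (psub_ectx 0 \<rho> F) t))"
    using refl control_stuck_imp_stuck[OF nf] by (intro r_stuck) auto
  then obtain s1 where "weak_trans rstep LTau (TermSt [] (rev \<rho>') s') (LStuck MEHole) s1"
    using env_bisim_step[OF bisim] by blast
  then obtain u where u: "red\<^sup>*\<^sup>* s' u" "stuck u"
    by (auto simp: weak_trans_not_tau rtaus_Term elim!: rstep_TermE)
  have "closed_trm s'"
    using env_bisim_states[OF bisim] by (auto simp: states_def)
  then have "control_stuck u"
    using u stuck_iff_control_stuck reds_closed_at by blast
  then show "halts control_stuck (eplug (psub_ectx 0 \<rho>' F) t')"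
    using s'(1) u(1) by (auto simp: halts_iff intro: rtranclp_trans)
qed

interpretation original: environment_simulation True p_env p_trm
proof
  fix \<rho> \<rho>'
  assume "p_env \<rho> \<rho>'"
  then show "length \<rho> = length \<rho>' \<and> (\<forall>v \<in> set \<rho>. closed_val v) \<and> (\<forall>v \<in> set \<rho>'. closed_val v)"
    by (auto simp: p_env_def pstates_def closed_env_def dest!: env_bisim_p_states)
next
  fix \<rho> t \<rho>' t'
  assume "p_trm \<rho> t \<rho>' t'"
  then show "(\<forall>v \<in> set \<rho>. closed_val v) \<and> closed_trm t \<and> (True \<longrightarrow> pure_trm t)"
    by (auto simp: p_trm_def pstates_def closed_env_def dest!: env_bisim_p_states)
next
  fix \<rho> \<rho>' i b b' w F
  assume env: "p_env \<rho> \<rho>'" and i: "i < length \<rho>" and b: "\<rho> ! i = Lam b" "\<rho>' ! i = Lam b'"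
    and w: "closed_at_val (length \<rho>) w" and F: "closed_at_ectx (length \<rho>) F"
    and "True \<longrightarrow> delimited F"
  then have delim: "delimited F"
    by simp
  have len: "length \<rho> = length \<rho>'" and bisim: "env_bisim_p (EnvSt [] (rev \<rho>)) (EnvSt [] (rev \<rho>'))"
    using env by (auto simp: p_env_def)
  let ?i = "length \<rho> - Suc i" and ?V = "val_to_mval (length \<rho>) 0 w"
    and ?F = "ectx_to_mectx (length \<rho>) F"
    and ?r = "eplug (psub_ectx 0 \<rho> F) (subst_trm 0 (psub_val 0 \<rho> w) b)"
    and ?r' = "eplug (psub_ectx 0 \<rho>' F) (subst_trm 0 (psub_val 0 \<rho>' w) b')"
  have V: "mval_fill [] (rev \<rho>) ?V = psub_val 0 \<rho> w" "mval_fill [] (rev \<rho>') ?V = psub_val 0 \<rho>' w"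
    "closed_mval [] (rev \<rho>) ?V"
    using trm_to_mctx(2)[of 0 \<rho> w] trm_to_mctx(2)[of 0 \<rho>' w] w len by auto
  have F': "mectx_fill [] (rev \<rho>) ?F = psub_ectx 0 \<rho> F" "mectx_fill [] (rev \<rho>') ?F = psub_ectx 0 \<rho>' F"
    "closed_mectx [] (rev \<rho>) ?F"
    using ectx_to_mectx[of \<rho> F] ectx_to_mectx[of \<rho>' F] F len by auto
  have nth: "rev \<rho> ! ?i = Lam b" "rev \<rho>' ! ?i = Lam b'" "?i < length (rev \<rho>)"
    using i b len by (auto simp: rev_nth)
  have "pstep (EnvSt [] (rev \<rho>)) (PLam ?i ?V ?F) (TermSt [] (rev \<rho>) ?r)"
    using p_lam[OF nth(3,1) V(3) F'(3)] V(1) F'(1) delim by simp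
  then obtain s where "weak_trans pstep PTau (EnvSt [] (rev \<rho>')) (PLam ?i ?V ?F) s"
    "env_bisim_p (TermSt [] (rev \<rho>) ?r) s"
    using env_bisim_p_step[OF bisim] by blast
  moreover have "pure_trm ?r'"
    using delim by (simp add: delimited_pure_trm)
  ultimately obtain r' where r': "red\<^sup>*\<^sup>* ?r' r'" "p_trm \<rho> ?r \<rho>' r'"
    using nth(2) V(2) F'(2) len
    by (auto simp: weak_trans_not_tau ptaus_Env ptaus_Term p_trm_def elim!: pstep_EnvE)
  \<comment> \<open>The label already contains \<open>F\<close>, so the whole programs are related
    and the remaining context is empty.\<close>
  show "\<exists>G r r'. closed_at_ectx (length \<rho>) G \<and> admissible True G \<and> p_trm \<rho> r \<rho>' r' \<and>
      ?r = eplug (psub_ectx 0 \<rho> G) r \<and> red\<^sup>*\<^sup>* ?r' (eplug (psub_ectx 0 \<rho>' G) r')"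
    by (rule exI[of _ EHole], rule exI[of _ ?r], rule exI[of _ r']) (simp add: admissible_def r')
next
  fix \<rho> t \<rho>' t' s
  assume trm: "p_trm \<rho> t \<rho>' t'" and red: "red t s"
  then have len: "length \<rho> = length \<rho>'"
    and bisim: "env_bisim_p (TermSt [] (rev \<rho>) t) (TermSt [] (rev \<rho>') t')"
    by (auto simp: p_trm_def)
  have pure: "pure_trm t" "pure_trm t'"
    using env_bisim_p_states[OF bisim] by (auto simp: pstates_def)
  show "\<exists>s'. red\<^sup>*\<^sup>* t' s' \<and> p_trm \<rho> s \<rho>' s'"
    using env_bisim_p_step[OF bisim p_tau[OF pure(1) red]] len pure(2)
    by (auto simp: p_trm_def weak_trans_tau ptaus_Term)
next
  fix \<rho> v \<rho>' t'
  assume trm: "p_trm \<rho> (Val v) \<rho>' t'"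
  then have len: "length \<rho> = length \<rho>'"
    and bisim: "env_bisim_p (TermSt [] (rev \<rho>) (Val v)) (TermSt [] (rev \<rho>') t')"
    by (auto simp: p_trm_def)
  have pure: "pure_trm t'"
    using trm by (auto simp: p_trm_def pstates_def dest!: env_bisim_p_states)
  show "\<exists>v'. red\<^sup>*\<^sup>* t' (Val v') \<and> p_env (v # \<rho>) (v' # \<rho>')"
    using env_bisim_p_step[OF bisim p_val] len pure
    by (auto simp: weak_trans_not_tau ptaus_Env ptaus_Term p_env_def elim!: pstep_TermE)
next
  fix \<rho> t \<rho>' t' F s
  assume "p_trm \<rho> t \<rho>' t'" "control_stuck t"
  then have False
    by (auto simp: p_trm_def pstates_def pure_trm_not_control_stuck dest!: env_bisim_p_states)
  then show "\<exists>s'. red\<^sup>*\<^sup>* (eplug (psub_ectx 0 \<rho>' F) t') s' \<and> p_trm \<rho> s \<rho>' s'" ..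
next
  fix \<rho> t \<rho>' t' F
  assume "p_trm \<rho> t \<rho>' t'" "control_stuck t"
  then have False
    by (auto simp: p_trm_def pstates_def pure_trm_not_control_stuck dest!: env_bisim_p_states)
  then show "halts control_stuck (eplug (psub_ectx 0 \<rho>' F) t')" ..
qed

lemma env_bisim_halts:
  assumes "env_bisim (TermSt [] [] t0) (TermSt [] [] t1)" "observable P" "closed_ectx F"
    "halts P (eplug F t0)"
  shows "halts P (eplug F t1)"
  using relaxed.TB_halts[of P t0 t1 F] assms by (simp add: r_trm_def admissible_def)

lemma env_bisim_imp_ctx_equiv:
  assumes t: "closed_trm t0" "closed_trm t1"
    and bisim: "env_bisim (TermSt [] [] t0) (TermSt [] [] t1)"
  shows "ctx_equiv t0 t1"
proof -
  have bisim': "env_bisim (TermSt [] [] t1) (TermSt [] [] t0)"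
    using bisimilar_sym[OF bisim[unfolded env_bisim_def]] by (simp add: env_bisim_def)
  have "halts P (cplug C t0) \<longleftrightarrow> halts P (cplug C t1)" if "closed_ctx C" "observable P" for C P
    using ciu_ctx[of P t0 t1 False C] ciu_ctx[of P t1 t0 False C] that t
      env_bisim_halts[OF bisim that(2)] env_bisim_halts[OF bisim' that(2)] by blast
  then show ?thesis
    by (auto simp: ctx_equiv_def evaluates_to_value_iff evaluates_to_control_stuck_iff observable_def)
qed

lemma ectx_cases:
  obtains "pure_ectx F" | G E where "pure_ectx E" "F = ecomp G (EReset E)"
proof -
  have "pure_ectx F \<or> (\<exists>G E. pure_ectx E \<and> F = ecomp G (EReset E))"
  proof (induction F)
    case (EReset F)
    then show ?case
      by (metis ecomp.simps(1) ecomp.simps(4))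
  qed (auto, (metis ecomp.simps)+)
  then show ?thesis
    using that by blast
qed

text \<open>The hypothesis concerns tested terms in a delimited pure context, so \<open>F\<close> is
  cut at its innermost delimiter. The outer part \<open>G\<close> is then empty or again delimited,
  hence admissible.\<close>

lemma env_bisim_p_halts:
  assumes bisim: "env_bisim_p_trm t0 t1" and F: "closed_ectx F" "delimited F"
    and halts: "halts is_value (eplug F t0)"
  shows "halts is_value (eplug F t1)"
proof (cases F rule: ectx_cases)
  case 1
  then show ?thesis
    using F(2) by (auto simp: delimited_def)
next
  case (2 G E)
  then have "p_trm [] (Reset (eplug E t0)) [] (Reset (eplug E t1))"
    using bisim F(1) by (simp add: env_bisim_p_trm_def p_trm_def)
  moreover have "admissible True G"
    using F(2) 2 by (cases G) (auto simp: admissible_def delimited_def)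
  ultimately show ?thesis
    using original.TB_halts[of is_value "Reset (eplug E t0)" "Reset (eplug E t1)" G] F(1) halts 2
    by (simp add: observable_def eplug_ecomp)
qed

lemma env_bisim_p_imp_ctx_equiv_p:
  assumes t: "closed_trm t0" "closed_trm t1" and bisim: "env_bisim_p_trm t0 t1"
  shows "ctx_equiv_p t0 t1"
proof -
  have bisim': "env_bisim_p_trm t1 t0"
    unfolding env_bisim_p_trm_def env_bisim_p_def
  proof (intro allI impI, rule bisimilar_sym)
    fix E
    assume "closed_ectx E \<and> pure_ectx E"
    then show "bisimilar pstates pstep PTau (TermSt [] [] (Reset (eplug E t0)))
        (TermSt [] [] (Reset (eplug E t1)))"
      using bisim by (simp add: env_bisim_p_trm_def env_bisim_p_def)
  qed
  have "halts is_value (Reset (cplug C t0)) \<longleftrightarrow> halts is_value (Reset (cplug C t1))"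
    if "closed_ctx C" for C
  proof -
    have obs: "observable is_value" and C: "closed_ctx (CReset C)"
      "True \<longrightarrow> (\<exists>C'. CReset C = CReset C')"
      using that by (simp_all add: observable_def)
    show ?thesis
      using ciu_ctx[OF obs t env_bisim_p_halts[OF bisim] C]
        ciu_ctx[OF obs t(2,1) env_bisim_p_halts[OF bisim'] C] by auto
  qed
  then show ?thesis
    by (simp add: ctx_equiv_p_def evaluates_to_value_iff)
qed

section \<open>Completeness\<close>

text \<open>A delimited program never ends control-stuck, so convergence to a value is the only
  observation in the original semantics.\<close>

definition observed :: "bool \<Rightarrow> (trm \<Rightarrow> bool) \<Rightarrow> bool" where
  "observed D P \<longleftrightarrow> observable P \<and> (D \<longrightarrow> P = is_value)"

definition equiv_env :: "bool \<Rightarrow> val list \<Rightarrow> val list \<Rightarrow> bool" where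
  "equiv_env D \<rho> \<rho>' \<longleftrightarrow> length \<rho> = length \<rho>' \<and>
    (\<forall>v \<in> set \<rho>. closed_val v) \<and> (\<forall>v \<in> set \<rho>'. closed_val v) \<and>
    (\<forall>P c. observed D P \<longrightarrow> closed_at_trm (length \<rho>) c \<longrightarrow> (D \<longrightarrow> pure_trm c) \<longrightarrow>
      (halts P (psub_trm 0 \<rho> c) \<longleftrightarrow> halts P (psub_trm 0 \<rho>' c)))"

definition equiv_trm :: "bool \<Rightarrow> val list \<Rightarrow> trm \<Rightarrow> val list \<Rightarrow> trm \<Rightarrow> bool" where
  "equiv_trm D \<rho> t \<rho>' t' \<longleftrightarrow> length \<rho> = length \<rho>' \<and>
    (\<forall>v \<in> set \<rho>. closed_val v) \<and> (\<forall>v \<in> set \<rho>'. closed_val v) \<and>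
    closed_trm t \<and> closed_trm t' \<and> (D \<longrightarrow> pure_trm t \<and> pure_trm t') \<and>
    (\<forall>P F. observed D P \<longrightarrow> closed_at_ectx (length \<rho>) F \<longrightarrow> admissible D F \<longrightarrow>
      (halts P (eplug (psub_ectx 0 \<rho> F) t) \<longleftrightarrow> halts P (eplug (psub_ectx 0 \<rho>' F) t')))"

lemma observed_is_value: "observed D is_value"
  by (simp add: observed_def observable_def)

lemma observed_observable: "observed D P \<Longrightarrow> observable P"
  by (simp add: observed_def)

lemma equiv_envD:
  "\<lbrakk>equiv_env D \<rho> \<rho>'; observed D P; closed_at_trm (length \<rho>) c; D \<longrightarrow> pure_trm c\<rbrakk> \<Longrightarrow>
    halts P (psub_trm 0 \<rho> c) \<longleftrightarrow> halts P (psub_trm 0 \<rho>' c)"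
  by (simp add: equiv_env_def)

lemma equiv_trmD:
  "\<lbrakk>equiv_trm D \<rho> t \<rho>' t'; observed D P; closed_at_ectx (length \<rho>) F; admissible D F\<rbrakk> \<Longrightarrow>
    halts P (eplug (psub_ectx 0 \<rho> F) t) \<longleftrightarrow> halts P (eplug (psub_ectx 0 \<rho>' F) t')"
  by (simp add: equiv_trm_def)

lemma equiv_env_sym: "equiv_env D \<rho> \<rho>' \<Longrightarrow> equiv_env D \<rho>' \<rho>"
  by (simp add: equiv_env_def)

lemma equiv_trm_sym: "equiv_trm D \<rho> t \<rho>' t' \<Longrightarrow> equiv_trm D \<rho>' t' \<rho> t"
  by (simp add: equiv_trm_def)

text \<open>By determinism a program in a context terminates iff its reducts do. Silent transitions
  can therefore be answered by standing still.\<close>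

lemma equiv_trm_reds:
  assumes equiv: "equiv_trm D \<rho> t \<rho>' t'" and reds: "red\<^sup>*\<^sup>* t s"
  shows "equiv_trm D \<rho> s \<rho>' t'"
proof -
  have "halts P (eplug F s) \<longleftrightarrow> halts P (eplug F t)" if "observed D P" for P F
    using halts_reds[OF reds_eplug[OF reds] observed_observable[OF that]] by simp
  moreover have "closed_trm s" "D \<longrightarrow> pure_trm s"
    using equiv reds_closed_at[OF reds] pure_trm_reds[OF reds] by (auto simp: equiv_trm_def)
  ultimately show ?thesis
    using equiv by (auto simp: equiv_trm_def)
qed

lemma equiv_trm_halts:
  assumes "equiv_trm D \<rho> t \<rho>' t'" "observed D P" "halts P t"
  shows "halts P t'"
  using equiv_trmD[OF assms(1,2), of EHole] assms(3) by (simp add: admissible_def)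

lemma equiv_trm_Val:
  assumes equiv: "equiv_trm D \<rho> (Val v) \<rho>' (Val v')"
  shows "equiv_env D (v # \<rho>) (v' # \<rho>')"
proof -
  have \<rho>: "length \<rho> = length \<rho>'" "\<And>v. v \<in> set \<rho> \<Longrightarrow> closed_val v" "\<And>v. v \<in> set \<rho>' \<Longrightarrow> closed_val v"
    "closed_val v" "closed_val v'"
    using equiv by (auto simp: equiv_trm_def)
  have "halts P (psub_trm 0 (v # \<rho>) c) \<longleftrightarrow> halts P (psub_trm 0 (v' # \<rho>') c)"
    if P: "observed D P" and c: "closed_at_trm (Suc (length \<rho>)) c" "D \<longrightarrow> pure_trm c" for P c
  proof (cases D)
    case False
    let ?F = "EAppR (Lam c) EHole"
    have "red (eplug (psub_ectx 0 \<rho> ?F) (Val v)) (psub_trm 0 (v # \<rho>) c)"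
      "red (eplug (psub_ectx 0 \<rho>' ?F) (Val v')) (psub_trm 0 (v' # \<rho>') c)"
      using c \<rho> by (simp_all add: red_iff_decompose psub_Cons)
    then show ?thesis
      using equiv_trmD[OF equiv P, of ?F] False c(1) halts_red[OF observed_observable[OF P]]
      by (simp add: admissible_def)
  next
    case True
    show ?thesis
    proof (cases "is_value c")
      case True
      then show ?thesis
        using P \<open>D\<close> by (auto simp: is_value_def observed_def intro!: halts_of_nf)
    next
      case False
      then obtain c0 where c0: "c = Reset c0"
        using c(2) True by (auto simp: pure_trm_def)
      \<comment> \<open>The context \<open>(\<lambda>x. c) \<box>\<close> is not admissible here.
        The delimiter of the pure non-value \<open>c\<close> is moved outside the application, and
        beta inside it restores \<open>c\<close>.\<close>
      let ?F = "EReset (EAppR (Lam c0) EHole)"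
      have "red (eplug (psub_ectx 0 \<rho> ?F) (Val v)) (psub_trm 0 (v # \<rho>) c)"
        "red (eplug (psub_ectx 0 \<rho>' ?F) (Val v')) (psub_trm 0 (v' # \<rho>') c)"
        using c \<rho> by (simp_all add: red_iff_decompose psub_Cons c0)
      then show ?thesis
        using equiv_trmD[OF equiv P, of ?F] c(1) halts_red[OF observed_observable[OF P]]
        by (simp add: admissible_def delimited_def c0)
    qed
  qed
  then show ?thesis
    using \<rho> by (auto simp: equiv_env_def)
qed

lemma equiv_trm_val:
  assumes equiv: "equiv_trm D \<rho> (Val v) \<rho>' t'"
  shows "\<exists>v'. red\<^sup>*\<^sup>* t' (Val v') \<and> equiv_env D (v # \<rho>) (v' # \<rho>')"
proof -
  have "halts is_value t'"
    using equiv_trm_halts[OF equiv observed_is_value] by (simp add: halts_of_nf is_value_def)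
  then obtain v' where v': "red\<^sup>*\<^sup>* t' (Val v')"
    by (auto simp: halts_iff is_value_def)
  then have "equiv_trm D \<rho> (Val v) \<rho>' (Val v')"
    using equiv_trm_reds[OF equiv_trm_sym[OF equiv]] equiv_trm_sym by blast
  then show ?thesis
    using v' equiv_trm_Val by blast
qed

text \<open>The open program that applies variable \<open>i\<close> to \<open>w\<close> inside
  \<open>F\<close> reaches the two results by one beta step on each side, and this remains so inside
  any further context \<open>G\<close>.\<close>

lemma equiv_env_lam:
  assumes equiv: "equiv_env D \<rho> \<rho>'" and i: "i < length \<rho>" and b: "\<rho> ! i = Lam b" "\<rho>' ! i = Lam b'"
    and w: "closed_at_val (length \<rho>) w" and F: "closed_at_ectx (length \<rho>) F" "D \<longrightarrow> delimited F"
  shows "equiv_trm D \<rho> (eplug (psub_ectx 0 \<rho> F) (subst_trm 0 (psub_val 0 \<rho> w) b))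
    \<rho>' (eplug (psub_ectx 0 \<rho>' F) (subst_trm 0 (psub_val 0 \<rho>' w) b'))"
    (is "equiv_trm D \<rho> ?t \<rho>' ?t'")
proof -
  have \<rho>: "length \<rho> = length \<rho>'" "\<And>v. v \<in> set \<rho> \<Longrightarrow> closed_val v" "\<And>v. v \<in> set \<rho>' \<Longrightarrow> closed_val v"
    using equiv by (auto simp: equiv_env_def)
  let ?c = "\<lambda>G. eplug G (eplug F (App (Val (Var i)) (Val w)))"
  have red: "red (psub_trm 0 \<rho> (?c G)) (eplug (psub_ectx 0 \<rho> G) ?t)"
    "red (psub_trm 0 \<rho>' (?c G)) (eplug (psub_ectx 0 \<rho>' G) ?t')" for G
    using b red_eplug[OF red_beta] by simp_all
  have "closed_trm (psub_trm 0 \<rho> (?c EHole))" "closed_trm (psub_trm 0 \<rho>' (?c EHole))"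
    by (rule closed_at_psub; use \<rho> w F(1) i in simp)+
  then have "closed_trm ?t" "closed_trm ?t'"
    using red_closed_at[OF red(1)[of EHole]] red_closed_at[OF red(2)[of EHole]] by simp_all
  moreover have "D \<longrightarrow> pure_trm ?t \<and> pure_trm ?t'"
    using F(2) by (simp add: delimited_pure_trm)
  moreover have "halts P (eplug (psub_ectx 0 \<rho> G) ?t) \<longleftrightarrow> halts P (eplug (psub_ectx 0 \<rho>' G) ?t')"
    if "observed D P" "closed_at_ectx (length \<rho>) G" "admissible D G" for P G
  proof -
    have "D \<longrightarrow> pure_trm (?c G)"
      using that(3) F(2) by (auto simp: admissible_def intro: delimited_pure_trm)
    then have "halts P (psub_trm 0 \<rho> (?c G)) \<longleftrightarrow> halts P (psub_trm 0 \<rho>' (?c G))"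
      using equiv_envD[OF equiv that(1), of "?c G"] that(2) i w F(1) by simp
    then show ?thesis
      using halts_red[OF observed_observable[OF that(1)] red(1)]
        halts_red[OF observed_observable[OF that(1)] red(2)] by simp
  qed
  ultimately show ?thesis
    using \<rho> by (auto simp: equiv_trm_def)
qed

lemma equiv_trm_stuck:
  assumes equiv: "equiv_trm False \<rho> t \<rho>' t'" and t: "stuck t" and F: "closed_at_ectx (length \<rho>) F"
    and s: "red_or_nf (eplug (psub_ectx 0 \<rho> F) t) s"
  shows "\<exists>u s'. red\<^sup>*\<^sup>* t' u \<and> stuck u \<and> red_or_nf (eplug (psub_ectx 0 \<rho>' F) u) s' \<and>
    equiv_trm False \<rho> s \<rho>' s'"
proof -
  have len: "length \<rho> = length \<rho>'" and "closed_trm t"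
    using equiv by (auto simp: equiv_trm_def)
  then have "halts control_stuck t"
    using t by (simp add: stuck_iff_control_stuck halts_of_nf)
  moreover have "observed False control_stuck"
    by (simp add: observed_def observable_def)
  ultimately have "halts control_stuck t'"
    using equiv_trm_halts[OF equiv] by blast
  then obtain u where u: "red\<^sup>*\<^sup>* t' u" "control_stuck u"
    by (auto simp: halts_iff)
  \<comment> \<open>Any successor will do: the two filled contexts are equivalent, and equivalence
    survives reduction on either side.\<close>
  obtain s' where s': "red_or_nf (eplug (psub_ectx 0 \<rho>' F) u) s'"
    using ex_red_or_nf by blast
  have equiv_u: "equiv_trm False \<rho> t \<rho>' u"
    using equiv_trm_reds[OF equiv_trm_sym[OF equiv] u(1)] equiv_trm_sym by blast
  have "equiv_trm False \<rho> (eplug (psub_ectx 0 \<rho> F) t) \<rho>' (eplug (psub_ectx 0 \<rho>' F) u)"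
    unfolding equiv_trm_def
  proof (intro conjI allI impI)
    fix P G
    assume "observed False P" "closed_at_ectx (length \<rho>) G"
    then have "halts P (eplug (psub_ectx 0 \<rho> (ecomp G F)) t) \<longleftrightarrow>
        halts P (eplug (psub_ectx 0 \<rho>' (ecomp G F)) u)"
      using equiv_trmD[OF equiv_u, of P "ecomp G F"] F by (simp add: admissible_def)
    then show "halts P (eplug (psub_ectx 0 \<rho> G) (eplug (psub_ectx 0 \<rho> F) t)) \<longleftrightarrow>
        halts P (eplug (psub_ectx 0 \<rho>' G) (eplug (psub_ectx 0 \<rho>' F) u))"
      by (simp add: eplug_ecomp)
  qed (use equiv_u F len closed_at_psub_ectx[where d = 0] in \<open>auto simp: equiv_trm_def\<close>)
  moreover have "red\<^sup>*\<^sup>* (eplug (psub_ectx 0 \<rho> F) t) s" "red\<^sup>*\<^sup>* (eplug (psub_ectx 0 \<rho>' F) u) s'"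
    using s s' by (auto simp: red_or_nf_def)
  ultimately have "equiv_trm False \<rho> s \<rho>' s'"
    using equiv_trm_reds equiv_trm_sym by blast
  then show ?thesis
    using u s' control_stuck_imp_stuck by blast
qed

section \<open>Contextual equivalence of states is a bisimulation\<close>

inductive equiv_state :: "bool \<Rightarrow> state \<Rightarrow> state \<Rightarrow> bool" for D where
  "equiv_trm D \<rho> t \<rho>' t' \<Longrightarrow> equiv_state D (TermSt [] (rev \<rho>) t) (TermSt [] (rev \<rho>') t')"
| "equiv_env D \<rho> \<rho>' \<Longrightarrow> equiv_state D (EnvSt [] (rev \<rho>)) (EnvSt [] (rev \<rho>'))"

lemma equiv_state_sym: "equiv_state D s s' \<Longrightarrow> equiv_state D s' s"
  by (induction rule: equiv_state.induct) (auto intro: equiv_state.intros equiv_trm_sym equiv_env_sym)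

lemma equiv_env_Lam:
  assumes "equiv_env D \<rho> \<rho>'" "i < length \<rho>"
  obtains b' where "rev \<rho>' ! i = Lam b'" "i < length \<rho>'"
proof -
  have "closed_val (rev \<rho>' ! i)" "i < length \<rho>'"
    using assms nth_mem[of i "rev \<rho>'"] by (auto simp: equiv_env_def)
  then show ?thesis
    using that closed_val_Lam by blast
qed

lemma mctx_ok_length:
  "length \<Gamma> = length \<Gamma>' \<Longrightarrow> mctx_ok \<Phi> \<Gamma> d C \<longleftrightarrow> mctx_ok \<Phi> \<Gamma>' d C"
  "length \<Gamma> = length \<Gamma>' \<Longrightarrow> mval_ok \<Phi> \<Gamma> d V \<longleftrightarrow> mval_ok \<Phi> \<Gamma>' d V"
  by (induction C and V arbitrary: d and d rule: mctx.induct mval.induct) auto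

lemma mectx_ok_length:
  "length \<Gamma> = length \<Gamma>' \<Longrightarrow> mectx_ok \<Phi> \<Gamma> d F \<longleftrightarrow> mectx_ok \<Phi> \<Gamma>' d F"
  by (induction F) (auto simp: mctx_ok_length[of \<Gamma> \<Gamma>'])

lemma equiv_env_lam_step:
  assumes equiv: "equiv_env D \<rho> \<rho>'" and i: "i < length (rev \<rho>)"
    and b: "rev \<rho> ! i = Lam b" "rev \<rho>' ! i = Lam b'"
    and V: "closed_mval [] (rev \<rho>) V" and F: "closed_mectx [] (rev \<rho>) F"
    "D \<longrightarrow> delimited (mectx_fill [] (rev \<rho>) F)"
  shows "closed_mval [] (rev \<rho>') V" "closed_mectx [] (rev \<rho>') F"
    and "D \<longrightarrow> delimited (mectx_fill [] (rev \<rho>') F)"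
    and "equiv_trm D
      \<rho> (eplug (mectx_fill [] (rev \<rho>) F) (subst_trm 0 (mval_fill [] (rev \<rho>) V) b))
      \<rho>' (eplug (mectx_fill [] (rev \<rho>') F) (subst_trm 0 (mval_fill [] (rev \<rho>') V) b'))"
proof -
  have len: "length \<rho> = length \<rho>'"
    using equiv by (simp add: equiv_env_def)
  show V': "closed_mval [] (rev \<rho>') V"
    using V mctx_ok_length(2)[of "rev \<rho>" "rev \<rho>'"] len by simp
  show F': "closed_mectx [] (rev \<rho>') F"
    using F(1) mectx_ok_length[of "rev \<rho>" "rev \<rho>'"] len by simp
  note enc = mctx_to_trm(2)[OF V] mctx_to_trm(2)[OF V'] mectx_to_ectx[OF F(1)] mectx_to_ectx[OF F']
  show "D \<longrightarrow> delimited (mectx_fill [] (rev \<rho>') F)"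
    using enc F(2) len by simp
  have "\<rho> ! (length \<rho> - Suc i) = Lam b" "\<rho>' ! (length \<rho> - Suc i) = Lam b'"
    using b i len by (auto simp: rev_nth)
  then show "equiv_trm D
      \<rho> (eplug (mectx_fill [] (rev \<rho>) F) (subst_trm 0 (mval_fill [] (rev \<rho>) V) b))
      \<rho>' (eplug (mectx_fill [] (rev \<rho>') F) (subst_trm 0 (mval_fill [] (rev \<rho>') V) b'))"
    using equiv_env_lam[OF equiv, of "length \<rho> - Suc i" b b' "mval_to_val (length \<rho>) 0 V"
        "mectx_to_ectx (length \<rho>) F"] enc i F(2) len by simp
qed

lemma equiv_state_rstep:
  assumes "equiv_state False s s'" "rstep s \<alpha> s1"
  shows "\<exists>s1'. weak_trans rstep LTau s' \<alpha> s1' \<and> equiv_state False s1 s1'"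
  using assms(1)
proof cases
  case (1 \<rho> t \<rho>' t')
  have len: "length \<rho> = length \<rho>'"
    using 1(3) by (simp add: equiv_trm_def)
  from assms(2)[unfolded 1(1)] show ?thesis
  proof cases
    case (r_tau u)
    \<comment> \<open>The answer to a silent step is the empty run, so \<open>s'\<close> stays where
      it is.\<close>
    then show ?thesis
      using equiv_trm_reds[OF 1(3), of u]
      by (intro exI[of _ s']) (auto simp: weak_trans_tau 1(2) intro: equiv_state.intros)
  next
    case (r_val v)
    then obtain v' where v': "red\<^sup>*\<^sup>* t' (Val v')" "equiv_env False (v # \<rho>) (v' # \<rho>')"
      using equiv_trm_val 1(3) by blast
    have "weak_trans rstep LTau s' LVal (EnvSt [] (rev \<rho>' @ [v']))"
      using v'(1) rstep.r_val[of "[]" "rev \<rho>'" v']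
      by (auto simp: 1(2) weak_trans_not_tau rtaus_Term rtaus_Env)
    then show ?thesis
      using equiv_state.intros(2)[OF v'(2)] r_val by auto
  next
    case (r_stuck F u)
    let ?F = "mectx_to_ectx (length \<rho>) F"
    have F: "closed_mectx [] (rev \<rho>) F" "closed_mectx [] (rev \<rho>') F"
      using mectx_ok_length[of "rev \<rho>" "rev \<rho>'"] r_stuck len by simp_all
    note enc = mectx_to_ectx[OF F(1)] mectx_to_ectx[OF F(2)]
    obtain w s2 where w: "red\<^sup>*\<^sup>* t' w" "stuck w" "red_or_nf (eplug (psub_ectx 0 \<rho>' ?F) w) s2"
      "equiv_trm False \<rho> u \<rho>' s2"
      using equiv_trm_stuck[OF 1(3), of ?F u] enc(1) r_stuck by auto
    have "weak_trans rstep LTau s' (LStuck F) (TermSt [] (rev \<rho>') s2)"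
      using w rstep.r_stuck[OF w(2) F(2), of s2] enc(2) len
      by (auto simp: 1(2) weak_trans_not_tau rtaus_Term)
    then show ?thesis
      using equiv_state.intros(1)[OF w(4)] r_stuck by auto
  qed
next
  case (2 \<rho> \<rho>')
  from assms(2)[unfolded 2(1)] show ?thesis
  proof cases
    case (r_lam i b V)
    then obtain b' where b': "rev \<rho>' ! i = Lam b'" "i < length \<rho>'"
      using equiv_env_Lam[OF 2(3), of i] by auto
    let ?s = "TermSt [] (rev \<rho>') (subst_trm 0 (mval_fill [] (rev \<rho>') V) b')"
    \<comment> \<open>The step lemma carries the context of the original labels; the relaxed label
      corresponds to the empty one.\<close>
    note step = equiv_env_lam_step[OF 2(3) _ _ b'(1), of b V MEHole]
    have "rstep s' (LLam i V) ?s"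
      using rstep.r_lam[of i "rev \<rho>'" b' "[]" V] b' step(1) r_lam by (simp add: 2(2))
    then have "weak_trans rstep LTau s' (LLam i V) ?s"
      by (auto simp: 2(2) weak_trans_not_tau rtaus_Env rtaus_Term)
    then show ?thesis
      using equiv_state.intros(1)[OF step(4)] r_lam by auto
  qed auto
qed

lemma equiv_state_pstep:
  assumes "equiv_state True s s'" "pstep s \<alpha> s1"
  shows "\<exists>s1'. weak_trans pstep PTau s' \<alpha> s1' \<and> equiv_state True s1 s1'"
  using assms(1)
proof cases
  case (1 \<rho> t \<rho>' t')
  have pure: "pure_trm t'"
    using 1(3) by (simp add: equiv_trm_def)
  from assms(2)[unfolded 1(1)] show ?thesis
  proof cases
    case (p_tau u)
    then show ?thesis
      using equiv_trm_reds[OF 1(3), of u]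
      by (intro exI[of _ s']) (auto simp: weak_trans_tau 1(2) intro: equiv_state.intros)
  next
    case (p_val v)
    then obtain v' where v': "red\<^sup>*\<^sup>* t' (Val v')" "equiv_env True (v # \<rho>) (v' # \<rho>')"
      using equiv_trm_val 1(3) by blast
    have "weak_trans pstep PTau s' PVal (EnvSt [] (rev \<rho>' @ [v']))"
      using v'(1) pstep.p_val[of "[]" "rev \<rho>'" v'] pure
      by (auto simp: 1(2) weak_trans_not_tau ptaus_Term ptaus_Env)
    then show ?thesis
      using equiv_state.intros(2)[OF v'(2)] p_val by auto
  qed
next
  case (2 \<rho> \<rho>')
  from assms(2)[unfolded 2(1)] show ?thesis
  proof cases
    case (p_lam i b V F)
    then obtain b' where b': "rev \<rho>' ! i = Lam b'" "i < length \<rho>'"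
      using equiv_env_Lam[OF 2(3), of i] by auto
    let ?t = "eplug (mectx_fill [] (rev \<rho>') F) (subst_trm 0 (mval_fill [] (rev \<rho>') V) b')"
    note step = equiv_env_lam_step[OF 2(3) _ _ b'(1), of b V F]
    have "pstep s' (PLam i V F) (TermSt [] (rev \<rho>') ?t)"
      using pstep.p_lam[of i "rev \<rho>'" b' "[]" V F] b' step(1-3) p_lam by (simp add: 2(2))
    then have "weak_trans pstep PTau s' (PLam i V F) (TermSt [] (rev \<rho>') ?t)"
      by (auto simp: 2(2) weak_trans_not_tau ptaus_Env)
    then show ?thesis
      using equiv_state.intros(1)[OF step(4)] p_lam by auto
  qed auto
qed

lemma equiv_trm_imp_env_bisim:
  assumes "equiv_trm False [] t0 [] t1"
  shows "env_bisim (TermSt [] [] t0) (TermSt [] [] t1)"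
proof -
  have "bisimulation states rstep LTau (equiv_state False)"
  proof (rule bisimulation_of_symmetric)
    show "s \<in> states" if "equiv_state False s s'" for s s'
      using that by cases (auto simp: equiv_trm_def equiv_env_def states_def closed_env_def)
  qed (auto intro: equiv_state_sym equiv_state_rstep)
  then show ?thesis
    using equiv_state.intros(1)[OF assms] by (auto simp: env_bisim_def bisimilar_def)
qed

lemma equiv_trm_imp_env_bisim_p:
  assumes "equiv_trm True [] t0 [] t1"
  shows "env_bisim_p (TermSt [] [] t0) (TermSt [] [] t1)"
proof -
  have "bisimulation pstates pstep PTau (equiv_state True)"
  proof (rule bisimulation_of_symmetric)
    show "s \<in> pstates" if "equiv_state True s s'" for s s'
      using that by cases (auto simp: equiv_trm_def equiv_env_def pstates_def closed_env_def)
  qed (auto intro: equiv_state_sym equiv_state_pstep)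
  then show ?thesis
    using equiv_state.intros(1)[OF assms] by (auto simp: env_bisim_p_def bisimilar_def)
qed

section \<open>From contextual equivalence of closed terms to bisimilarity\<close>

primrec ctx_of_ectx :: "ectx \<Rightarrow> ctx" where
  "ctx_of_ectx EHole = CHole"
| "ctx_of_ectx (EAppR v F) = CAppR (Val v) (ctx_of_ectx F)"
| "ctx_of_ectx (EAppL F t) = CAppL (ctx_of_ectx F) t"
| "ctx_of_ectx (EReset F) = CReset (ctx_of_ectx F)"

lemma cplug_ctx_of_ectx: "cplug (ctx_of_ectx F) t = eplug F t"
  by (induction F) auto

lemma closed_ctx_of_ectx: "closed_at_ctx n (ctx_of_ectx F) \<longleftrightarrow> closed_at_ectx n F"
  by (induction F) auto

lemma ctx_equiv_imp_env_bisim: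
  assumes t: "closed_trm t0" "closed_trm t1" and equiv: "ctx_equiv t0 t1"
  shows "env_bisim (TermSt [] [] t0) (TermSt [] [] t1)"
proof (rule equiv_trm_imp_env_bisim)
  have "halts P (eplug F t0) \<longleftrightarrow> halts P (eplug F t1)" if "observed False P" "closed_ectx F" for P F
  proof -
    have "closed_ctx (ctx_of_ectx F)"
      using that(2) by (simp add: closed_ctx_of_ectx)
    then show ?thesis
      using equiv that(1) cplug_ctx_of_ectx
      by (auto simp: ctx_equiv_def evaluates_to_value_iff evaluates_to_control_stuck_iff
          observed_def observable_def dest: spec[of _ "ctx_of_ectx F"])
  qed
  then show "equiv_trm False [] t0 [] t1"
    using t by (simp add: equiv_trm_def psub_ectx_closed_at)
qed

lemma ctx_equiv_p_imp_env_bisim_p: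
  assumes t: "closed_trm t0" "closed_trm t1" and equiv: "ctx_equiv_p t0 t1"
  shows "env_bisim_p_trm t0 t1"
  unfolding env_bisim_p_trm_def
proof (intro allI impI, rule equiv_trm_imp_env_bisim_p)
  fix E
  assume E: "closed_ectx E \<and> pure_ectx E"
  have "halts P (eplug F (Reset (eplug E t0))) \<longleftrightarrow> halts P (eplug F (Reset (eplug E t1)))"
    if P: "observed True P" and F: "closed_ectx F" "admissible True F" for P F
  proof -
    \<comment> \<open>Since \<open>F\<close> is empty or delimited, the composed context starts with
      a delimiter in either case. This is the outer delimiter built into \<open>ctx_equiv_p\<close>,
      and \<open>G\<close> is what remains as the tested context.\<close>
    obtain G where G: "ecomp F (EReset E) = EReset G"
      using F(2) by (auto simp: admissible_def delimited_def)
    moreover from this have "closed_ectx G"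
      using E F(1) closed_at_ectx_ecomp[of 0 F "EReset E"] by simp
    ultimately have "halts is_value (eplug (ecomp F (EReset E)) t0) \<longleftrightarrow>
        halts is_value (eplug (ecomp F (EReset E)) t1)"
      using equiv closed_ctx_of_ectx[of 0 G]
      by (auto simp: ctx_equiv_p_def evaluates_to_value_iff cplug_ctx_of_ectx
          dest!: spec[of _ "ctx_of_ectx G"])
    then show ?thesis
      using P by (simp add: observed_def eplug_ecomp)
  qed
  then show "equiv_trm True [] (Reset (eplug E t0)) [] (Reset (eplug E t1))"
    using t E by (simp add: equiv_trm_def psub_ectx_closed_at pure_trm_def)
qed

theorem theorem5p12:
  fixes t0 t1 :: trm
  assumes "closed_trm t0" and "closed_trm t1"
  shows "(ctx_equiv t0 t1 \<longleftrightarrow> env_bisim (TermSt [] [] t0) (TermSt [] [] t1)) \<and>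
         (ctx_equiv_p t0 t1 \<longleftrightarrow> env_bisim_p_trm t0 t1)"
  using assms env_bisim_imp_ctx_equiv env_bisim_p_imp_ctx_equiv_p
    ctx_equiv_imp_env_bisim ctx_equiv_p_imp_env_bisim_p by blast

end
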